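(* For every integer $a\ge 2$, the spider graph $S(a,2,1)$ is Schur positive, i.e., every coefficient of its chromatic symmetric function $X_{S(a,2,1)}$ in the Schur basis $\{s_\lambda\}$ is nonnegative.
   Context: For a simple graph $G$ with vertex set $\{v_1,v_2,\dots\}$, the chromatic symmetric function is $X_G(x_1,x_2,\dots)=\sum_{c} x_{c(v_1)}x_{c(v_2)}\cdots$, the sum over all proper colorings $c\colon V(G)\to\{1,2,3,\dots\}$ (adjacent vertices receive different colors). $G$ is Schur positive if all coefficients of $X_G$ in the basis of Schur functions are nonnegative. For a partition $\lambda=(\lambda_1,\lambda_2,\dots)$ of $n-1$, the spider $S(\lambda)$ is the tree on $n$ vertices obtained by taking paths $P_{\lambda_1+1},P_{\lambda_2+1},\dots$ (where $P_m$ is the path on $m$ vertices) and identifying one end vertex of each of them into a single vertex. Thus $S(a,2,1)$ has $a+4$ vertices. *)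

theory Defs
  imports "Graph_Theory.Pair_Digraph" "HOL-Library.Multiset" "HOL-Library.FuncSet"
begin

section \<open>Formal power series in countably many variables\<close>

text \<open>
  A monomial in the variables \<open>x\<^sub>1, x\<^sub>2, \<dots>\<close> is encoded as the finite multiset of the indices of its
  factors, and a formal power series with integer coefficients as its coefficient function.
\<close>

type_synonym series = "nat multiset \<Rightarrow> int"

text \<open>The monomial \<open>\<Prod>a\<in>A. x\<^bsub>f a\<^esub>\<close>.\<close>

definition monomial_of :: "('a \<Rightarrow> nat) \<Rightarrow> 'a set \<Rightarrow> nat multiset" where
  "monomial_of f A = image_mset f (mset_set A)"

section \<open>The chromatic symmetric function\<close>

text \<open>
  A finite simple graph is a \<^locale>\<open>pair_graph\<close>, each edge being represented by its two
  orientations.  Colorings are extensional functions, so that each coloring is counted once.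
\<close>

definition proper_colorings :: "'a pair_pre_digraph \<Rightarrow> ('a \<Rightarrow> nat) set" where
  "proper_colorings G =
     {c \<in> pverts G \<rightarrow>\<^sub>E {1..}. \<forall>u v. (u, v) \<in> parcs G \<longrightarrow> c u \<noteq> c v}"

definition chromatic_sf :: "'a pair_pre_digraph \<Rightarrow> series" where
  "chromatic_sf G m = int (card {c \<in> proper_colorings G. monomial_of c (pverts G) = m})"

section \<open>Schur functions\<close>

definition is_partition :: "nat list \<Rightarrow> bool" where
  "is_partition lam \<longleftrightarrow> sorted_wrt (\<ge>) lam \<and> (\<forall>k \<in> set lam. k > 0)"

text \<open>Rows and columns of a Young diagram are numbered from \<open>0\<close>, tableau entries from \<open>1\<close>.\<close>

definition young_diagram :: "nat list \<Rightarrow> (nat \<times> nat) set" where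
  "young_diagram lam = {(i, j). i < length lam \<and> j < lam ! i}"

definition ssyt :: "nat list \<Rightarrow> (nat \<times> nat \<Rightarrow> nat) set" where
  "ssyt lam = {T \<in> young_diagram lam \<rightarrow>\<^sub>E {1..}.
     (\<forall>i j. (i, j) \<in> young_diagram lam \<and> (i, Suc j) \<in> young_diagram lam
        \<longrightarrow> T (i, j) \<le> T (i, Suc j)) \<and>
     (\<forall>i j. (i, j) \<in> young_diagram lam \<and> (Suc i, j) \<in> young_diagram lam
        \<longrightarrow> T (i, j) < T (Suc i, j))}"

definition schur :: "nat list \<Rightarrow> series" where
  "schur lam m = int (card {T \<in> ssyt lam. monomial_of T (young_diagram lam) = m})"

definition schur_expansion :: "series \<Rightarrow> (nat list \<Rightarrow> int) \<Rightarrow> bool" where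
  "schur_expansion f c \<longleftrightarrow>
     finite {lam. c lam \<noteq> 0} \<and> (\<forall>lam. c lam \<noteq> 0 \<longrightarrow> is_partition lam) \<and>
     (\<forall>m. f m = (\<Sum>lam | c lam \<noteq> 0. c lam * schur lam m))"

text \<open>Well defined for every series with a Schur expansion: see \<open>schur_expansion_unique\<close> below.\<close>

definition schur_coeff :: "series \<Rightarrow> nat list \<Rightarrow> int" where
  "schur_coeff f = (THE c. schur_expansion f c)"

definition schur_positive :: "series \<Rightarrow> bool" where
  "schur_positive f \<longleftrightarrow>
     (\<exists>c. schur_expansion f c) \<and> (\<forall>lam. is_partition lam \<longrightarrow> schur_coeff f lam \<ge> 0)"

section \<open>Spiders\<close>

text \<open>
  Leg \<open>i\<close> is a path on the points \<open>spider_point i 0, \<dots>, spider_point i (lam ! i)\<close>; the initial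
  points of all legs are identified with \<open>(0, 0)\<close>.
\<close>

definition spider_point :: "nat \<Rightarrow> nat \<Rightarrow> nat \<times> nat" where
  "spider_point i j = (if j = 0 then (0, 0) else (i, j))"

definition spider_arcs :: "nat list \<Rightarrow> (nat \<times> nat) rel" where
  "spider_arcs lam =
     {(spider_point i j, spider_point i (Suc j)) | i j. i < length lam \<and> j < lam ! i}"

definition spider :: "nat list \<Rightarrow> (nat \<times> nat) pair_pre_digraph" where
  "spider lam =
     \<lparr> pverts = insert (0, 0) {spider_point i j | i j. i < length lam \<and> j \<le> lam ! i},
       parcs = spider_arcs lam \<union> (spider_arcs lam)\<inverse> \<rparr>"

lemma pverts_spider:
  "pverts (spider lam) = insert (0, 0) (SIGMA i:{..<length lam}. {1..lam ! i})"
proof (rule set_eqI)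
  fix x
  show "x \<in> pverts (spider lam) \<longleftrightarrow>
      x \<in> insert (0, 0) (SIGMA i:{..<length lam}. {1..lam ! i})"
    by (cases x; cases "snd x = 0") (auto simp: spider_def spider_point_def Suc_le_eq)
qed

lemma card_pverts_spider: "card (pverts (spider lam)) = sum_list lam + 1"
  by (simp add: pverts_spider sum_list_sum_nth atLeast0LessThan)

lemma pair_graph_spider: "pair_graph (spider lam)"
proof
  have fin: "finite (pverts (spider lam))"
    by (simp add: pverts_spider)
  show "finite (pverts (spider lam))" by (fact fin)
  show wf1: "fst e \<in> pverts (spider lam)" if "e \<in> parcs (spider lam)" for e
    using that by (fastforce simp: spider_def spider_arcs_def)
  show wf2: "snd e \<in> pverts (spider lam)" if "e \<in> parcs (spider lam)" for e
    using that by (fastforce simp: spider_def spider_arcs_def)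
  have "parcs (spider lam) \<subseteq> pverts (spider lam) \<times> pverts (spider lam)"
    using wf1 wf2 by (auto simp: mem_Times_iff)
  then show "finite (parcs (spider lam))"
    using fin finite_subset by blast
  show "fst e \<noteq> snd e" if "e \<in> parcs (spider lam)" for e
    using that by (auto simp: spider_def spider_arcs_def spider_point_def split: if_splits)
  have "sym (parcs (spider lam))"
    by (auto simp: spider_def sym_def)
  then show "symmetric (with_proj (spider lam))"
    by (simp add: symmetric_def)
qed

section \<open>Uniqueness of Schur expansions\<close>

definition part :: "nat list \<Rightarrow> nat \<Rightarrow> nat" where
  "part lam i = (if i < length lam then lam ! i else 0)"

definition part_sum :: "nat list \<Rightarrow> nat \<Rightarrow> nat" where
  "part_sum lam k = (\<Sum>i<k. part lam i)"

lemma young_diagram_part: "(i, j) \<in> young_diagram lam \<longleftrightarrow> j < part lam i"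
  by (auto simp: young_diagram_def part_def)

lemma finite_young_diagram: "finite (young_diagram lam)"
proof -
  have "young_diagram lam = (SIGMA i:{..<length lam}. {..<lam ! i})"
    by (auto simp: young_diagram_def)
  then show ?thesis by simp
qed

lemma card_first_rows: "card {x \<in> young_diagram lam. fst x < k} = part_sum lam k"
proof -
  have "{x \<in> young_diagram lam. fst x < k} = (SIGMA i:{..<k}. {..<part lam i})"
    by (auto simp: young_diagram_part)
  then show ?thesis by (simp add: part_sum_def)
qed

lemma part_Suc_le: "is_partition lam \<Longrightarrow> part lam (Suc i) \<le> part lam i"
  by (auto simp: is_partition_def part_def sorted_wrt_iff_nth_less)

lemma partition_eqI:
  assumes "is_partition lam" "is_partition mu" "\<And>i. part lam i = part mu i"
  shows "lam = mu"
proof -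
  have *: "part nu i > 0 \<longleftrightarrow> i < length nu" if "is_partition nu" for nu i
    using that by (auto simp: is_partition_def part_def)
  have "i < length lam \<longleftrightarrow> i < length mu" for i
    using *[OF assms(1), of i] *[OF assms(2), of i] assms(3)[of i] by simp
  then have len: "length lam = length mu"
    by (metis less_irrefl linorder_less_linear)
  show ?thesis
  proof (rule nth_equalityI[OF len])
    fix i assume "i < length lam"
    then show "lam ! i = mu ! i"
      using assms(3)[of i] len by (simp add: part_def)
  qed
qed

lemma ssyt_entry_gt:
  assumes "is_partition lam" "T \<in> ssyt lam" "(i, j) \<in> young_diagram lam"
  shows "i < T (i, j)"
  using assms(3)
proof (induction i)
  case 0
  then show ?case using assms(2) by (force simp: ssyt_def PiE_iff)
next
  case (Suc i)
  have "(i, j) \<in> young_diagram lam"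
    using Suc.prems part_Suc_le[OF assms(1), of i] by (simp add: young_diagram_part)
  then have "i < T (i, j)" "T (i, j) < T (Suc i, j)"
    using Suc assms(2) by (auto simp: ssyt_def)
  then show ?case by simp
qed

definition superstandard_monomial :: "nat list \<Rightarrow> nat multiset" where
  "superstandard_monomial mu = monomial_of (\<lambda>x. Suc (fst x)) (young_diagram mu)"

lemma card_entries_le:
  assumes "finite A"
  shows "card {x \<in> A. f x \<le> k} = size (filter_mset (\<lambda>n. n \<le> k) (monomial_of f A))"
  using assms by (simp add: monomial_of_def filter_mset_image_mset size_mset_set)

lemma schur_nonzero_dominates:
  assumes "is_partition lam" "schur lam (superstandard_monomial mu) \<noteq> 0"
  shows "part_sum mu k \<le> part_sum lam k"
proof -
  have "{T \<in> ssyt lam. monomial_of T (young_diagram lam) = superstandard_monomial mu} \<noteq> {}"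
    using assms(2) unfolding schur_def by (metis card.empty of_nat_0)
  then obtain T where T: "T \<in> ssyt lam"
    and mon: "monomial_of T (young_diagram lam) = superstandard_monomial mu" by blast
  have "part_sum mu k = card {x \<in> young_diagram mu. Suc (fst x) \<le> k}"
    by (simp add: card_first_rows[symmetric] Suc_le_eq)
  also have "\<dots> = card {x \<in> young_diagram lam. T x \<le> k}"
    using mon
    by (simp only: card_entries_le[OF finite_young_diagram] superstandard_monomial_def)
  also have "\<dots> \<le> card {x \<in> young_diagram lam. fst x < k}"
    using ssyt_entry_gt[OF assms(1) T]
    by (intro card_mono) (fastforce simp: finite_young_diagram)+
  finally show ?thesis by (simp add: card_first_rows)
qed

lemma schur_superstandard_nonzero:
  "schur mu (superstandard_monomial mu) \<noteq> 0"
proof -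
  let ?Y = "young_diagram mu"
  let ?S = "{T \<in> ssyt mu. monomial_of T ?Y = superstandard_monomial mu}"
  have "?S \<subseteq> ?Y \<rightarrow>\<^sub>E set_mset (superstandard_monomial mu)"
  proof
    fix T assume "T \<in> ?S"
    then have "T \<in> extensional ?Y" "T ` ?Y = set_mset (superstandard_monomial mu)"
      by (auto simp: ssyt_def monomial_of_def finite_young_diagram PiE_iff
          dest!: arg_cong[of _ _ set_mset])
    then show "T \<in> ?Y \<rightarrow>\<^sub>E set_mset (superstandard_monomial mu)"
      by (auto simp: PiE_iff)
  qed
  then have "finite ?S"
    by (rule finite_subset) (intro finite_PiE finite_young_diagram finite_set_mset)
  moreover have "restrict (\<lambda>x. Suc (fst x)) ?Y \<in> ?S"
    by (auto simp: ssyt_def superstandard_monomial_def monomial_of_def finite_young_diagram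
        intro!: image_mset_cong)
  ultimately show ?thesis by (auto simp: schur_def)
qed

lemma schur_independent:
  assumes fin: "finite A" and part: "\<And>lam. lam \<in> A \<Longrightarrow> is_partition lam"
    and zero: "\<And>m. (\<Sum>lam\<in>A. d lam * schur lam m) = 0"
    and "nu \<in> A"
  shows "d nu = 0"
proof (rule ccontr)
  assume nu: "d nu \<noteq> 0"
  define B where "B = {lam \<in> A. d lam \<noteq> 0}"
  define N where "N = Suc (Max (length ` A))"
  define w where "w lam = (\<Sum>k\<le>N. part_sum lam k)" for lam
  have "finite B" "B \<noteq> {}"
    using fin nu \<open>nu \<in> A\<close> by (auto simp: B_def)
  then have "Max (w ` B) \<in> w ` B" by simp
  then obtain mu where mu: "mu \<in> B" "w mu = Max (w ` B)" by auto
  have max: "w lam \<le> w mu" if "lam \<in> B" for lam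
    using that mu \<open>finite B\<close> by simp
  have len: "length lam < N" if "lam \<in> A" for lam
    using that fin by (simp add: N_def less_Suc_eq_le)
  have vanish: "d lam * schur lam (superstandard_monomial mu) = 0"
    if lam: "lam \<in> A" "lam \<noteq> mu" for lam
  proof (rule ccontr)
    assume *: "d lam * schur lam (superstandard_monomial mu) \<noteq> 0"
    then have "lam \<in> B" using lam by (simp add: B_def)
    have dom: "part_sum mu k \<le> part_sum lam k" for k
      using schur_nonzero_dominates[OF part[OF lam(1)]] * by simp
    have "part_sum mu k = part_sum lam k" if "k \<le> N" for k
    proof (rule ccontr)
      assume "part_sum mu k \<noteq> part_sum lam k"
      then have "part_sum mu k < part_sum lam k" using dom[of k] by simp
      then have "w mu < w lam"
        unfolding w_def using that dom by (intro sum_strict_mono_ex1) auto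
      then show False using max[OF \<open>lam \<in> B\<close>] by simp
    qed
    then have *: "part_sum mu (Suc i) = part_sum lam (Suc i) \<and> part_sum mu i = part_sum lam i"
      if "i < N" for i using that by simp
    have "part lam i = part mu i" for i
    proof (cases "i < N")
      case True
      then show ?thesis using *[OF True] by (simp add: part_sum_def)
    next
      case False
      then show ?thesis using len[OF lam(1)] len[of mu] mu by (simp add: part_def B_def)
    qed
    then have "lam = mu"
      using partition_eqI part lam(1) mu(1) by (auto simp: B_def)
    then show False using lam by simp
  qed
  have "mu \<in> A" using mu by (simp add: B_def)
  then have "(\<Sum>lam\<in>A. d lam * schur lam (superstandard_monomial mu)) =
      d mu * schur mu (superstandard_monomial mu)"
    using fin vanish by (simp add: sum.remove[of A mu] sum.neutral)
  then show False
    using zero mu schur_superstandard_nonzero[of mu] by (simp add: B_def)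
qed

theorem schur_expansion_unique:
  assumes c: "schur_expansion f c" and c': "schur_expansion f c'"
  shows "c = c'"
proof
  fix nu
  define A where "A = {lam. c lam \<noteq> 0} \<union> {lam. c' lam \<noteq> 0}"
  have fin: "finite A" and part: "\<And>lam. lam \<in> A \<Longrightarrow> is_partition lam"
    using c c' by (auto simp: A_def schur_expansion_def)
  have f: "f m = (\<Sum>lam\<in>A. c lam * schur lam m)" for m
    using c fin by (auto simp: schur_expansion_def A_def intro!: sum.mono_neutral_left)
  have f': "f m = (\<Sum>lam\<in>A. c' lam * schur lam m)" for m
    using c' fin by (auto simp: schur_expansion_def A_def intro!: sum.mono_neutral_left)
  have "(\<Sum>lam\<in>A. (c lam - c' lam) * schur lam m) = 0" for m
    using f[of m] f'[of m] by (simp add: left_diff_distrib sum_subtractf)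
  from schur_independent[OF fin part this, of nu] show "c nu = c' nu"
    by (cases "nu \<in> A") (auto simp: A_def)
qed

corollary schur_coeff_eq: "schur_expansion f c \<Longrightarrow> schur_coeff f = c"
  unfolding schur_coeff_def using schur_expansion_unique by blast

corollary schur_positiveI:
  "schur_expansion f c \<Longrightarrow> (\<And>lam. is_partition lam \<Longrightarrow> c lam \<ge> 0) \<Longrightarrow> schur_positive f"
  using schur_coeff_eq by (auto simp: schur_positive_def)

end

theory Submission
  imports Defs "HOL-Library.Poly_Mapping" "HOL-Computational_Algebra.Formal_Power_Series"
begin

text \<open>
  Write \<open>P\<^sub>n\<close> for the chromatic symmetric function of the path on \<open>n\<close> vertices and \<open>n = a + 4\<close>.
  Summing over the color of the centre gives \<open>X = P\<^sub>n + P\<^sub>1 P\<^bsub>n-1\<^esub> - P\<^sub>3 P\<^bsub>n-3\<^esub>\<close> for \<open>S(a,2,1)\<close>.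
  Since \<open>\<Sum> P\<^sub>n z\<^sup>n = E(z) / (1 - \<Sum> (i - 1) e\<^sub>i z\<^sup>i)\<close>, everything can be expanded in elementary symmetric
  functions, and the negative terms can be absorbed so that only products of elementary symmetric
  functions, possibly times \<open>e\<^sub>1 e\<^sub>2 - e\<^sub>3 = s\<^bsub>21\<^esub>\<close> or \<open>e\<^sub>2 e\<^sub>2 - e\<^sub>1 e\<^sub>3 = s\<^bsub>22\<^esub>\<close>, remain.  These are Schur
  positive by the dual Pieri rule, which is proved by induction on the number of variables.
\<close>

section \<open>Shapes and strips\<close>

text \<open>Elementary products alone do not suffice for this cancellation: e_1 e_2 - e_3 is not a
  nonnegative combination of them, so the leftovers have to be read as Schur functions. Each
  surviving term has at most one factor s_21 or s_22, all others being elementary, so multiplication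
  by a single e_k is the only product rule needed and the Littlewood-Richardson rule is avoided. The
  number N of variables stays explicit because removing the last variable drives the Pieri
  induction, and because a series coefficient at a monomial m is a polynomial coefficient as soon as
  N bounds the indices in m. The values x lie in an arbitrary commutative ring; they become formal
  variables only when coefficients are compared.\<close>

text \<open>
  Partitions are handled as weakly decreasing sequences of row lengths with finite support, so that
  strips can be described row by row without bookkeeping about the number of parts.
\<close>

definition shape :: "(nat \<Rightarrow> nat) \<Rightarrow> bool" where
  "shape l \<longleftrightarrow> (\<forall>i. l (Suc i) \<le> l i) \<and> finite {i. 0 < l i}"

definition cells :: "(nat \<Rightarrow> nat) \<Rightarrow> (nat \<times> nat) set" where
  "cells l = {(i, j). j < l i}"

definition add_boxes :: "(nat \<Rightarrow> nat) \<Rightarrow> nat set \<Rightarrow> nat \<Rightarrow> nat" where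
  "add_boxes l S = (\<lambda>i. l i + of_bool (i \<in> S))"

definition del_boxes :: "(nat \<Rightarrow> nat) \<Rightarrow> nat set \<Rightarrow> nat \<Rightarrow> nat" where
  "del_boxes l S = (\<lambda>i. l i - of_bool (i \<in> S))"

text \<open>Interlacing of l and m says that l/m has no two cells in one column; it also forces m to
  be weakly decreasing.\<close>

definition remove_hstrip :: "(nat \<Rightarrow> nat) \<Rightarrow> (nat \<Rightarrow> nat) set" where
  "remove_hstrip l = {m. \<forall>i. l (Suc i) \<le> m i \<and> m i \<le> l i}"

definition add_vstrip :: "(nat \<Rightarrow> nat) \<Rightarrow> nat \<Rightarrow> (nat \<Rightarrow> nat) set" where
  "add_vstrip l k = {m. \<exists>S. finite S \<and> card S = k \<and> m = add_boxes l S \<and> shape m}"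

lemma shape_antimono: "shape l \<Longrightarrow> i \<le> j \<Longrightarrow> l j \<le> l i"
  unfolding shape_def by (metis lift_Suc_antimono_le)

lemma finite_cells: "shape l \<Longrightarrow> finite (cells l)"
proof -
  assume "shape l"
  then have "finite (SIGMA i:{i. 0 < l i}. {..<l i})" by (auto simp: shape_def)
  then show ?thesis by (rule finite_subset[rotated]) (auto simp: cells_def)
qed

lemma inj_add_boxes: "inj (add_boxes l)"
  by (rule injI) (auto simp: add_boxes_def fun_eq_iff set_eq_iff of_bool_eq_iff)

lemma shape_remove_hstrip:
  assumes "shape l" "m \<in> remove_hstrip l"
  shows "shape m"
proof -
  have "m (Suc i) \<le> m i" for i
    using assms(2) unfolding remove_hstrip_def by (metis (no_types, lifting) le_trans mem_Collect_eq)
  moreover have "{i. 0 < m i} \<subseteq> {i. 0 < l i}"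
    using assms(2) unfolding remove_hstrip_def by (auto intro: less_le_trans)
  ultimately show ?thesis using assms(1) finite_subset unfolding shape_def by blast
qed

lemma shape_add_vstrip: "m \<in> add_vstrip l k \<Longrightarrow> shape m"
  by (auto simp: add_vstrip_def)

lemma finite_bounded_functions:
  fixes b :: "nat \<Rightarrow> nat"
  assumes "finite {i. 0 < b i}"
  shows "finite {m. \<forall>i. m i \<le> b i}"
proof -
  let ?I = "{i. 0 < b i}"
  have "finite (\<Pi>\<^sub>E i\<in>?I. {..b i})" using assms by (intro finite_PiE) auto
  moreover have "{m. \<forall>i. m i \<le> b i} \<subseteq> (\<lambda>f i. if i \<in> ?I then f i else 0) ` (\<Pi>\<^sub>E i\<in>?I. {..b i})"
  proof
    fix m assume m: "m \<in> {m. \<forall>i. m i \<le> b i}"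
    have "m i = (if i \<in> ?I then restrict m ?I i else 0)" for i
      using m by (cases "b i = 0") (auto dest: spec[of _ i])
    then have "m = (\<lambda>i. if i \<in> ?I then restrict m ?I i else 0)" by blast
    moreover have "restrict m ?I \<in> (\<Pi>\<^sub>E i\<in>?I. {..b i})" using m by auto
    ultimately show "m \<in> (\<lambda>f i. if i \<in> ?I then f i else 0) ` (\<Pi>\<^sub>E i\<in>?I. {..b i})" by blast
  qed
  ultimately show ?thesis using finite_subset by blast
qed

lemma finite_remove_hstrip: "shape l \<Longrightarrow> finite (remove_hstrip l)"
  using finite_bounded_functions[of l]
  by (rule_tac finite_subset[of _ "{m. \<forall>i. m i \<le> l i}"]) (auto simp: shape_def remove_hstrip_def)

text \<open>Below the support of l the new rows have length 0 or 1 and still decrease, so a box in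
  row i forces boxes in all rows from n to i.\<close>

lemma add_vstrip_rows_bounded:
  assumes "shape l" "finite S" "shape (add_boxes l S)" "i \<in> S" "\<forall>j\<ge>n. l j = 0"
  shows "i < n + card S"
proof (rule ccontr)
  assume i: "\<not> i < n + card S"
  have "{n..i} \<subseteq> S"
  proof
    fix j assume j: "j \<in> {n..i}"
    have "1 \<le> add_boxes l S i" using assms(4) by (simp add: add_boxes_def)
    also have "\<dots> \<le> add_boxes l S j" using shape_antimono[OF assms(3)] j by simp
    finally show "j \<in> S" using assms(5) j by (auto simp: add_boxes_def of_bool_def split: if_splits)
  qed
  then have "card {n..i} \<le> card S" using assms(2) by (rule card_mono[rotated])
  then show False using i by simp
qed

lemma shape_eventually_zero:
  assumes "shape l"
  obtains n where "\<forall>j\<ge>n. l j = 0"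
proof -
  obtain n where "\<forall>j\<in>{i. 0 < l i}. j < n"
    using assms finite_nat_set_iff_bounded unfolding shape_def by blast
  then show ?thesis using that[of n] by force
qed

lemma finite_add_vstrip:
  assumes "shape l"
  shows "finite (add_vstrip l k)"
proof -
  obtain n where n: "\<forall>j\<ge>n. l j = 0" using shape_eventually_zero[OF assms] .
  have "add_vstrip l k \<subseteq> add_boxes l ` Pow {..<n + k}"
    using add_vstrip_rows_bounded[OF assms _ _ _ n] by (auto simp: add_vstrip_def)
  then show ?thesis by (rule finite_subset) simp
qed

lemma cells_add_boxes: "cells (add_boxes l S) = cells l \<union> (\<lambda>i. (i, l i)) ` S"
  by (auto simp: cells_def add_boxes_def of_bool_def less_Suc_eq split: if_splits)

lemma card_cells_add_boxes:
  assumes "shape l" "finite S"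
  shows "card (cells (add_boxes l S)) = card (cells l) + card S"
proof -
  have "card (cells (add_boxes l S)) = card (cells l) + card ((\<lambda>i. (i, l i)) ` S)"
    unfolding cells_add_boxes using finite_cells[OF assms(1)] assms(2)
    by (intro card_Un_disjoint) (auto simp: cells_def)
  also have "card ((\<lambda>i. (i, l i)) ` S) = card S" by (rule card_image) (auto simp: inj_on_def)
  finally show ?thesis .
qed

lemma card_cells_add_vstrip:
  "shape l \<Longrightarrow> m \<in> add_vstrip l k \<Longrightarrow> card (cells m) = card (cells l) + k"
  by (auto simp: add_vstrip_def card_cells_add_boxes)

lemma cells_remove_hstrip: "m \<in> remove_hstrip l \<Longrightarrow> cells m \<subseteq> cells l"
  by (force simp: remove_hstrip_def cells_def intro: less_le_trans)

section \<open>Commutation of vertical and horizontal strips\<close>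

lemma card_subsets_between:
  assumes "finite B" "Z \<subseteq> B"
  shows "card {S. Z \<subseteq> S \<and> S \<subseteq> B \<and> card S = k} =
    (if card Z \<le> k then (card B - card Z) choose (k - card Z) else 0)"
proof (cases "card Z \<le> k")
  case True
  have fZ: "finite Z" using assms finite_subset by blast
  have "bij_betw (\<lambda>S. S - Z) {S. Z \<subseteq> S \<and> S \<subseteq> B \<and> card S = k}
      {T. T \<subseteq> B - Z \<and> card T = k - card Z}"
  proof (rule bij_betw_byWitness[where f' = "\<lambda>T. T \<union> Z"], goal_cases)
    case 4
    have "card (T \<union> Z) = k" if "T \<subseteq> B - Z" "card T = k - card Z" for T
    proof -
      have "finite T" using that assms(1) finite_subset by blast
      then show ?thesis using that fZ True by (subst card_Un_disjoint) auto
    qed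
    then show ?case using assms(2) by auto
  qed (use fZ in \<open>auto simp: card_Diff_subset\<close>)
  then have "card {S. Z \<subseteq> S \<and> S \<subseteq> B \<and> card S = k} = card (B - Z) choose (k - card Z)"
    using assms(1) by (simp add: bij_betw_same_card n_subsets)
  then show ?thesis using True assms fZ by (simp add: card_Diff_subset)
next
  case False
  have "k \<noteq> card S" if "Z \<subseteq> S" "S \<subseteq> B" for S
    using False card_mono[of S Z] that finite_subset[OF _ assms(1), of S] by auto
  then have "{S. Z \<subseteq> S \<and> S \<subseteq> B \<and> card S = k} = {}" by blast
  then show ?thesis using False by (simp only: card.empty if_False)
qed

text \<open>Pascal's rule after deleting the forced elements Z. Only the sizes of B and B' are
  compared, since in the application B is a shifted copy of B' with 0 added.\<close>

lemma card_subsets_between_Suc: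
  assumes "finite B" "finite B'" "Z \<subseteq> B" "Z \<subseteq> B'" "card B = Suc (card B')"
  shows "card {S. Z \<subseteq> S \<and> S \<subseteq> B \<and> card S = Suc k} =
    card {S. Z \<subseteq> S \<and> S \<subseteq> B' \<and> card S = Suc k} + card {S. Z \<subseteq> S \<and> S \<subseteq> B' \<and> card S = k}"
proof -
  have "card Z \<le> card B'" using assms by (simp add: card_mono)
  then have "card B - card Z = Suc (card B' - card Z)" using assms(5) by simp
  moreover have "Suc k - card Z = Suc (k - card Z)" if "card Z \<le> k" using that by simp
  moreover have "card Z = Suc k" if "\<not> card Z \<le> k" "card Z \<le> Suc k" using that by simp
  ultimately show ?thesis using assms(1-4) by (auto simp: card_subsets_between)
qed

text \<open>For shapes, this decides whether n arises from l by a vertical strip added and a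
  horizontal strip removed, sizes left open; the criterion is the same for both orders.\<close>

definition strip_compatible :: "(nat \<Rightarrow> nat) \<Rightarrow> (nat \<Rightarrow> nat) \<Rightarrow> bool" where
  "strip_compatible l n \<longleftrightarrow> (\<forall>i. n i \<le> Suc (l i) \<and> l (Suc i) \<le> n i)"

text \<open>Row i must receive a box if n is longer there, and row i + 1 may receive one only if it
  stays at most n i. Nothing restricts row 0, hence the \<open>insert 0\<close>.\<close>

lemma up_down_strips:
  assumes "shape l" "shape n"
  shows "{m \<in> add_vstrip l k. n \<in> remove_hstrip m} =
    (if strip_compatible l n then add_boxes l `
       {S. {i. l i < n i} \<subseteq> S \<and> S \<subseteq> insert 0 (Suc ` {i. l (Suc i) < n i}) \<and> card S = k} else {})"
    (is "?L = ?R")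
proof -
  have fB: "finite (insert 0 (Suc ` {i. l (Suc i) < n i}))"
    using assms(2) unfolding shape_def
    by (intro finite.insertI finite_imageI) (auto elim: finite_subset[rotated])
  have eq: "n \<in> remove_hstrip (add_boxes l S) \<longleftrightarrow> strip_compatible l n \<and>
      {i. l i < n i} \<subseteq> S \<and> S \<subseteq> insert 0 (Suc ` {i. l (Suc i) < n i})" for S
  proof -
    have "S \<subseteq> insert 0 (Suc ` {i. l (Suc i) < n i}) \<longleftrightarrow> (\<forall>i. Suc i \<in> S \<longrightarrow> l (Suc i) < n i)"
      by (auto simp: subset_iff image_iff) (metis not0_implies_Suc)
    moreover have "(add_boxes l S (Suc i) \<le> n i \<and> n i \<le> add_boxes l S i) \<longleftrightarrow>
        (n i \<le> Suc (l i) \<and> l (Suc i) \<le> n i) \<and> (l i < n i \<longrightarrow> i \<in> S) \<and> (Suc i \<in> S \<longrightarrow> l (Suc i) < n i)"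
      for i by (cases "i \<in> S"; cases "Suc i \<in> S") (auto simp: add_boxes_def)
    ultimately show ?thesis unfolding remove_hstrip_def strip_compatible_def by blast
  qed
  have sh: "shape (add_boxes l S)" if n: "n \<in> remove_hstrip (add_boxes l S)" and S: "finite S" for S
  proof -
    have "add_boxes l S (Suc i) \<le> add_boxes l S i" for i
      using n unfolding remove_hstrip_def by (metis (no_types, lifting) le_trans mem_Collect_eq)
    moreover have "{i. 0 < add_boxes l S i} \<subseteq> {i. 0 < l i} \<union> S"
      by (auto simp: add_boxes_def)
    then have "finite {i. 0 < add_boxes l S i}"
      using assms(1) S finite_subset unfolding shape_def by blast
    ultimately show ?thesis by (simp add: shape_def)
  qed
  have "?L = {add_boxes l S | S. finite S \<and> card S = k \<and> n \<in> remove_hstrip (add_boxes l S)}"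
    unfolding add_vstrip_def using sh by blast
  also have "\<dots> = ?R"
    unfolding eq using fB finite_subset by (auto simp: image_iff)
  finally show ?thesis .
qed

text \<open>Here the intermediate shape is n with boxes taken back: forced where n exceeds l,
  allowed where n i stays at least l (i + 1). In contrast to \<open>up_down_strips\<close>, no row
  is free of restriction.\<close>

lemma down_up_strips:
  assumes "shape l" "shape n"
  shows "{m \<in> remove_hstrip l. n \<in> add_vstrip m k} =
    (if strip_compatible l n then del_boxes n `
       {S. {i. l i < n i} \<subseteq> S \<and> S \<subseteq> {i. l (Suc i) < n i} \<and> card S = k} else {})"
    (is "?L = ?R")
proof -
  have fB: "finite {i. l (Suc i) < n i}"
    using assms(2) unfolding shape_def by (auto elim: finite_subset[rotated])
  have eq: "del_boxes n S \<in> remove_hstrip l \<and> (\<forall>i\<in>S. 0 < n i) \<longleftrightarrow> strip_compatible l n \<and>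
      {i. l i < n i} \<subseteq> S \<and> S \<subseteq> {i. l (Suc i) < n i}" for S
  proof -
    have "(l (Suc i) \<le> del_boxes n S i \<and> del_boxes n S i \<le> l i) \<and> (i \<in> S \<longrightarrow> 0 < n i) \<longleftrightarrow>
        (n i \<le> Suc (l i) \<and> l (Suc i) \<le> n i) \<and> (l i < n i \<longrightarrow> i \<in> S) \<and> (i \<in> S \<longrightarrow> l (Suc i) < n i)"
      for i by (cases "i \<in> S") (auto simp: del_boxes_def)
    then show ?thesis unfolding remove_hstrip_def strip_compatible_def by blast
  qed
  \<comment> \<open>Subtraction truncates at 0, so deleting boxes inverts adding them only for
    nonempty rows.\<close>
  have inv: "n = add_boxes m S \<longleftrightarrow> m = del_boxes n S \<and> (\<forall>i\<in>S. 0 < n i)" for m S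
    by (auto simp: add_boxes_def del_boxes_def fun_eq_iff of_bool_def)
  have "?L = {del_boxes n S | S. finite S \<and> card S = k \<and>
      del_boxes n S \<in> remove_hstrip l \<and> (\<forall>i\<in>S. 0 < n i)}"
    unfolding add_vstrip_def mem_Collect_eq inv using assms(2) by blast
  also have "\<dots> = ?R"
    unfolding eq using fB finite_subset by (auto simp: image_iff)
  finally show ?thesis .
qed

text \<open>The one additional free row in \<open>up_down_strips\<close> either takes a box or does
  not; this is Pascal's rule and gives the two terms.\<close>

lemma card_up_down_strips:
  assumes "shape l" "shape n"
  shows "card {m \<in> add_vstrip l (Suc k). n \<in> remove_hstrip m} =
    card {m \<in> remove_hstrip l. n \<in> add_vstrip m (Suc k)} + card {m \<in> remove_hstrip l. n \<in> add_vstrip m k}"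
proof (cases "strip_compatible l n")
  case True
  let ?Z = "{i. l i < n i}" and ?B = "{i. l (Suc i) < n i}"
  have fB: "finite ?B"
    using assms(2) unfolding shape_def by (auto elim: finite_subset[rotated])
  have "inj_on (del_boxes n) {S. ?Z \<subseteq> S \<and> S \<subseteq> ?B \<and> card S = k'}" for k'
  proof (rule inj_on_inverseI)
    fix S assume "S \<in> {S. ?Z \<subseteq> S \<and> S \<subseteq> ?B \<and> card S = k'}"
    then have "\<And>i. i \<in> S \<Longrightarrow> 0 < n i" by (auto simp: subset_iff)
    then show "{i. del_boxes n S i < n i} = S"
      by (auto simp: del_boxes_def split: if_splits)
  qed
  moreover have "?Z \<subseteq> ?B"
    using assms(1) le_less_trans unfolding shape_def by blast
  moreover have "?Z \<subseteq> insert 0 (Suc ` ?B)"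
  proof
    fix i assume i: "i \<in> ?Z"
    have "n i \<le> n (i - 1)" by (rule shape_antimono[OF assms(2)]) simp
    with i show "i \<in> insert 0 (Suc ` ?B)" by (cases i) auto
  qed
  moreover have "card (insert 0 (Suc ` ?B)) = Suc (card ?B)"
    using fB by (simp add: card_image)
  ultimately show ?thesis
    using True fB
    by (simp add: up_down_strips down_up_strips assms card_image inj_on_subset[OF inj_add_boxes]
        card_subsets_between_Suc)
next
  case False
  then show ?thesis by (simp add: up_down_strips down_up_strips assms)
qed

section \<open>Schur polynomials and the dual Pieri rule\<close>

definition tableaux :: "(nat \<Rightarrow> nat) \<Rightarrow> nat \<Rightarrow> (nat \<times> nat \<Rightarrow> nat) set" where
  "tableaux l N = {T \<in> cells l \<rightarrow>\<^sub>E {1..N}.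
     (\<forall>i j. Suc j < l i \<longrightarrow> T (i, j) \<le> T (i, Suc j)) \<and>
     (\<forall>i j. j < l (Suc i) \<longrightarrow> T (i, j) < T (Suc i, j))}"

definition schur_poly :: "(nat \<Rightarrow> 'a::comm_ring_1) \<Rightarrow> (nat \<Rightarrow> nat) \<Rightarrow> nat \<Rightarrow> 'a" where
  "schur_poly x l N = (\<Sum>T\<in>tableaux l N. \<Prod>b\<in>cells l. x (T b))"

lemma finite_tableaux: "shape l \<Longrightarrow> finite (tableaux l N)"
  unfolding tableaux_def by (rule finite_subset[of _ "cells l \<rightarrow>\<^sub>E {1..N}"])
    (auto intro!: finite_PiE finite_cells)

lemma tableaux_range: "T \<in> tableaux l N \<Longrightarrow> j < l i \<Longrightarrow> 1 \<le> T (i, j) \<and> T (i, j) \<le> N"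
  by (auto simp: tableaux_def cells_def PiE_iff)

lemma tableaux_row_mono:
  assumes "T \<in> tableaux l N" "j' \<le> j" "j < l i"
  shows "T (i, j') \<le> T (i, j)"
  using assms(2,3)
proof (induction j rule: dec_induct)
  case (step j)
  then have "T (i, j') \<le> T (i, j)" by simp
  also have "\<dots> \<le> T (i, Suc j)" using assms(1) step.prems by (simp add: tableaux_def)
  finally show ?case .
qed simp

definition inner_shape :: "(nat \<Rightarrow> nat) \<Rightarrow> nat \<Rightarrow> (nat \<times> nat \<Rightarrow> nat) \<Rightarrow> nat \<Rightarrow> nat" where
  "inner_shape l N T i = card {j. j < l i \<and> T (i, j) \<le> N}"

lemma down_closed_eq_lessThan:
  assumes "finite D" "\<And>j j'. j \<in> D \<Longrightarrow> j' \<le> j \<Longrightarrow> j' \<in> D"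
  shows "D = {..<card D}"
proof (rule card_subset_eq[symmetric])
  show "{..<card D} \<subseteq> D"
  proof
    fix j assume j: "j \<in> {..<card D}"
    show "j \<in> D"
    proof (rule ccontr)
      assume "j \<notin> D"
      then have "D \<subseteq> {..<j}" using assms(2) by (meson lessThan_iff not_le subsetI)
      then have "card D \<le> j" using card_mono[of "{..<j}" D] by simp
      then show False using j by simp
    qed
  qed
qed (use assms(1) in auto)

lemma less_inner_shape_iff:
  assumes "T \<in> tableaux l M"
  shows "j < inner_shape l N T i \<longleftrightarrow> j < l i \<and> T (i, j) \<le> N"
proof -
  define D where "D = {j. j < l i \<and> T (i, j) \<le> N}"
  have "finite D" unfolding D_def by simp
  have "j' \<in> D" if "j \<in> D" "j' \<le> j" for j j'
    using that tableaux_row_mono[OF assms, of j' j i] unfolding D_def by auto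
  with \<open>finite D\<close> have "D = {..<card D}" by (rule down_closed_eq_lessThan)
  then show ?thesis unfolding inner_shape_def D_def by blast
qed

text \<open>Columns increase strictly up to N + 1, so no cell lies below an entry N + 1.\<close>

lemma inner_shape_remove_hstrip:
  assumes "shape l" "T \<in> tableaux l (Suc N)"
  shows "inner_shape l N T \<in> remove_hstrip l"
  unfolding remove_hstrip_def
proof (intro CollectI allI conjI)
  fix i
  let ?m = "inner_shape l N T"
  note iff = less_inner_shape_iff[OF assms(2)]
  show "?m i \<le> l i" using iff[of "l i" N i] by simp
  show "l (Suc i) \<le> ?m i"
  proof (rule ccontr)
    assume *: "\<not> l (Suc i) \<le> ?m i"
    then have "?m i < l i" using shape_antimono[OF assms(1), of i "Suc i"] by simp
    then have "N < T (i, ?m i)" using iff[of "?m i" N i] by simp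
    moreover have "T (i, ?m i) < T (Suc i, ?m i)" using assms(2) * by (simp add: tableaux_def)
    moreover have "T (Suc i, ?m i) \<le> Suc N" using tableaux_range[OF assms(2)] * by simp
    ultimately show False by simp
  qed
qed

text \<open>Branching: the cells containing the largest entry form a horizontal strip.\<close>

lemma schur_poly_Suc:
  assumes l: "shape l"
  shows "schur_poly x l (Suc N) =
    (\<Sum>m\<in>remove_hstrip l. x (Suc N) ^ card (cells l - cells m) * schur_poly x m N)"
proof -
  \<comment> \<open>The inverse of cutting a tableau down to its entries up to N; the value
    \<open>undefined\<close> keeps the filling extensional.\<close>
  define ext where "ext m T = (\<lambda>b. if b \<in> cells m then T b else if b \<in> cells l then Suc N else undefined)"
    for m and T :: "nat \<times> nat \<Rightarrow> nat"
  have inner: "cells (inner_shape l N T) = {b \<in> cells l. T b \<le> N}" if "T \<in> tableaux l (Suc N)" for T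
    using less_inner_shape_iff[OF that] by (auto simp: cells_def)
  have ext_tab: "ext m T \<in> tableaux l (Suc N)" if m: "m \<in> remove_hstrip l" and T: "T \<in> tableaux m N" for m T
  proof -
    note rng = tableaux_range[OF T]
    have int: "l (Suc i) \<le> m i" "m i \<le> l i" for i using m by (auto simp: remove_hstrip_def)
    have val: "ext m T (i, j) = (if j < m i then T (i, j) else Suc N)" if "j < l i" for i j
      using that by (simp add: ext_def cells_def)
    have "ext m T \<in> cells l \<rightarrow>\<^sub>E {1..Suc N}"
    proof (rule PiE_I)
      fix b assume "b \<in> cells l"
      then show "ext m T b \<in> {1..Suc N}" using rng[of "snd b" "fst b"] by (cases b) (auto simp: cells_def val)
    next
      fix b assume "b \<notin> cells l"
      then show "ext m T b = undefined"
        using cells_remove_hstrip[OF m] by (auto simp: ext_def)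
    qed
    moreover have "ext m T (i, j) \<le> ext m T (i, Suc j)" if "Suc j < l i" for i j
      using that T rng[of j i] by (auto simp: val tableaux_def)
    moreover have "ext m T (i, j) < ext m T (Suc i, j)" if "j < l (Suc i)" for i j
      using that T rng[of j i] int(1)[of i] int(2)[of i] by (auto simp: val tableaux_def)
    ultimately show ?thesis by (simp add: tableaux_def)
  qed
  have "(\<Sum>m\<in>remove_hstrip l. x (Suc N) ^ card (cells l - cells m) * schur_poly x m N) =
      (\<Sum>(m, T)\<in>Sigma (remove_hstrip l) (\<lambda>m. tableaux m N).
         x (Suc N) ^ card (cells l - cells m) * (\<Prod>b\<in>cells m. x (T b)))"
    unfolding schur_poly_def sum_distrib_left
    by (rule sum.Sigma) (auto simp: l finite_remove_hstrip intro: finite_tableaux[OF shape_remove_hstrip[OF l]])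
  also have "\<dots> = schur_poly x l (Suc N)"
    unfolding schur_poly_def
  proof (rule sum.reindex_bij_witness[where
        j = "\<lambda>(m, T). ext m T" and
        i = "\<lambda>T. (inner_shape l N T, restrict T (cells (inner_shape l N T)))"], goal_cases)
    case (1 p)
    obtain m T where p: "p = (m, T)" and m: "m \<in> remove_hstrip l" and T: "T \<in> tableaux m N"
      using 1 by auto
    note tab = ext_tab[OF m T]
    have sub: "m i \<le> l i" for i using m by (simp add: remove_hstrip_def)
    have less: "j < inner_shape l N (ext m T) i \<longleftrightarrow> j < m i" for i j
      unfolding less_inner_shape_iff[OF tab]
      using tableaux_range[OF T, of j i] sub[of i]
      by (auto simp: ext_def cells_def split: if_splits)
    have "inner_shape l N (ext m T) = m"
    proof (rule HOL.ext)
      fix i show "inner_shape l N (ext m T) i = m i"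
        using less[of "m i" i] less[of "inner_shape l N (ext m T) i" i] by simp
    qed
    moreover have "restrict (ext m T) (cells m) = T"
    proof (rule HOL.ext)
      fix b
      have "T \<in> cells m \<rightarrow>\<^sub>E {1..N}" using T by (simp add: tableaux_def)
      then show "restrict (ext m T) (cells m) b = T b"
        using PiE_arb[of T "cells m" _ b] by (simp add: ext_def)
    qed
    ultimately show ?case by (simp add: p)
  next
    case (2 p)
    then show ?case using ext_tab by auto
  next
    case (3 T)
    have "ext (inner_shape l N T) (restrict T (cells (inner_shape l N T))) b = T b" for b
    proof (cases "b \<in> cells l")
      case True
      then have "T b \<le> Suc N" using tableaux_range[OF 3] by (cases b) (simp add: cells_def)
      then show ?thesis using True by (auto simp: ext_def inner[OF 3])
    next
      case False
      then have "T b = undefined" using 3 unfolding tableaux_def by (metis (no_types, lifting) PiE_arb mem_Collect_eq)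
      then show ?thesis using False by (simp add: ext_def inner[OF 3])
    qed
    then show ?case by auto
  next
    case (4 T)
    let ?m = "inner_shape l N T"
    note iff = less_inner_shape_iff[OF 4]
    have hs: "?m \<in> remove_hstrip l" using inner_shape_remove_hstrip[OF l 4] .
    have sub: "?m i \<le> l i" "l (Suc i) \<le> ?m i" for i using hs by (auto simp: remove_hstrip_def)
    have dec: "?m (Suc i) \<le> ?m i" for i using sub(1)[of "Suc i"] sub(2)[of i] by simp
    have "restrict T (cells ?m) \<in> tableaux ?m N"
      unfolding tableaux_def
    proof (intro CollectI conjI allI impI PiE_I)
      fix b assume "b \<in> cells ?m"
      then show "restrict T (cells ?m) b \<in> {1..N}"
        using tableaux_range[OF 4, of "snd b" "fst b"] by (cases b) (auto simp: cells_def iff)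
    next
      fix i j assume "Suc j < ?m i"
      then show "restrict T (cells ?m) (i, j) \<le> restrict T (cells ?m) (i, Suc j)"
        using 4 sub(1)[of i] by (auto simp: cells_def tableaux_def)
    next
      fix i j assume *: "j < ?m (Suc i)"
      then have "j < ?m i" using dec[of i] by simp
      with * show "restrict T (cells ?m) (i, j) < restrict T (cells ?m) (Suc i, j)"
        using 4 sub(1)[of "Suc i"] by (auto simp: cells_def tableaux_def)
    qed auto
    then show ?case using hs by simp
  next
    case (5 p)
    obtain m T where p: "p = (m, T)" and m: "m \<in> remove_hstrip l" and T: "T \<in> tableaux m N"
      using 5 by auto
    have sub: "cells m \<subseteq> cells l" using cells_remove_hstrip[OF m] .
    have "(\<Prod>b\<in>cells l. x (ext m T b)) =
        (\<Prod>b\<in>cells l - cells m. x (ext m T b)) * (\<Prod>b\<in>cells m. x (ext m T b))"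
      by (rule prod.subset_diff[OF sub finite_cells[OF l]])
    also have "(\<Prod>b\<in>cells l - cells m. x (ext m T b)) = x (Suc N) ^ card (cells l - cells m)"
      by (simp add: ext_def)
    also have "(\<Prod>b\<in>cells m. x (ext m T b)) = (\<Prod>b\<in>cells m. x (T b))"
      by (simp add: ext_def)
    finally show ?case by (simp add: p)
  qed
  finally show ?thesis by simp
qed

lemma schur_poly_empty: "schur_poly x (\<lambda>_. 0) N = 1"
proof -
  have "tableaux (\<lambda>_. 0) N = {\<lambda>_. undefined}" by (auto simp: tableaux_def cells_def)
  then show ?thesis by (simp add: schur_poly_def cells_def)
qed

lemma schur_poly_no_variables:
  assumes "cells l \<noteq> {}"
  shows "schur_poly x l 0 = 0"
proof -
  have "tableaux l 0 = {}" using assms by (auto simp: tableaux_def PiE_iff)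
  then show ?thesis by (simp add: schur_poly_def)
qed

section \<open>Elementary symmetric polynomials and multiplication by them\<close>

definition elem_gf :: "(nat \<Rightarrow> 'a::comm_ring_1) \<Rightarrow> nat \<Rightarrow> 'a fps" where
  "elem_gf x N = (\<Prod>c\<in>{1..N}. 1 + fps_const (x c) * fps_X)"

text \<open>Taken as a coefficient of the product instead of a sum over subsets: the recursion in N
  for the Pieri induction and the product form for path generating functions are then both at
  hand.\<close>

definition elem :: "(nat \<Rightarrow> 'a::comm_ring_1) \<Rightarrow> nat \<Rightarrow> nat \<Rightarrow> 'a" where
  "elem x k N = fps_nth (elem_gf x N) k"

lemma elem_gf_Suc: "elem_gf x (Suc N) = elem_gf x N + fps_const (x (Suc N)) * (fps_X * elem_gf x N)"
  by (simp add: elem_gf_def atLeastAtMostSuc_conv algebra_simps)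

lemma elem_Suc_Suc: "elem x (Suc k) (Suc N) = elem x (Suc k) N + x (Suc N) * elem x k N"
  by (simp add: elem_def elem_gf_Suc)

lemma elem_0 [simp]: "elem x 0 N = 1"
  by (induction N) (simp_all add: elem_def elem_gf_Suc, simp add: elem_gf_def)

lemma elem_Suc_no_variables: "elem x (Suc k) 0 = 0"
  by (simp add: elem_def elem_gf_def)

lemma add_vstrip_0: "shape l \<Longrightarrow> add_vstrip l 0 = {l}"
proof -
  assume l: "shape l"
  have l0: "add_boxes l {} = l" by (simp add: add_boxes_def)
  show ?thesis
  proof (intro equalityI subsetI)
    fix m assume "m \<in> add_vstrip l 0"
    then obtain S where "S = {}" "m = add_boxes l S" by (auto simp: add_vstrip_def)
    then show "m \<in> {l}" by (simp add: l0)
  next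
    fix m assume m: "m \<in> {l}"
    show "m \<in> add_vstrip l 0"
      unfolding add_vstrip_def by (intro CollectI exI[of _ "{}"]) (use l m in \<open>simp add: l0\<close>)
  qed
qed

text \<open>U may be any finite superset of the second components, so that sums over differently
  ordered strip pairs can be compared over one index set.\<close>

lemma sum_pairs_by_second:
  fixes W :: "'b \<Rightarrow> 'c::comm_ring_1"
  assumes "finite A" "finite U" "\<And>a. a \<in> A \<Longrightarrow> F a \<subseteq> U"
  shows "(\<Sum>a\<in>A. \<Sum>n\<in>F a. W n) = (\<Sum>n\<in>U. of_nat (card {a \<in> A. n \<in> F a}) * W n)"
proof -
  have "(\<Sum>a\<in>A. \<Sum>n\<in>F a. W n) = (\<Sum>a\<in>A. \<Sum>n\<in>U. if n \<in> F a then W n else 0)"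
  proof (rule sum.cong)
    fix a assume "a \<in> A"
    then show "(\<Sum>n\<in>F a. W n) = (\<Sum>n\<in>U. if n \<in> F a then W n else 0)"
      by (simp add: sum.inter_restrict[OF assms(2), symmetric] Int_absorb1 assms(3))
  qed simp
  also have "\<dots> = (\<Sum>n\<in>U. \<Sum>a\<in>A. if n \<in> F a then W n else 0)" by (rule sum.swap)
  also have "\<dots> = (\<Sum>n\<in>U. of_nat (card {a \<in> A. n \<in> F a}) * W n)"
    using assms(1) by (intro sum.cong refl) (simp add: sum.inter_filter[symmetric])
  finally show ?thesis .
qed

text \<open>
  Induction on the number of variables: after branching, both sides are sums over pairs of strips,
  and they agree because adding vertical strips commutes with removing horizontal ones up to
  the factor accounted for by \<open>card_up_down_strips\<close>.
\<close>

theorem dual_Pieri: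
  assumes "shape l"
  shows "elem x k N * schur_poly x l N = (\<Sum>m\<in>add_vstrip l k. schur_poly x m N)"
  using assms
proof (induction N arbitrary: l k)
  case 0
  show ?case
  proof (cases k)
    case 0
    then show ?thesis using \<open>shape l\<close> by (simp add: add_vstrip_0)
  next
    case (Suc k')
    have "schur_poly x m 0 = 0" if "m \<in> add_vstrip l k" for m
      using card_cells_add_vstrip[OF \<open>shape l\<close> that] Suc
      by (intro schur_poly_no_variables) auto
    then show ?thesis using Suc by (simp add: elem_Suc_no_variables)
  qed
next
  case (Suc N)
  note l = \<open>shape l\<close>
  show ?case
  proof (cases k)
    case 0
    then show ?thesis using l by (simp add: add_vstrip_0)
  next
    case k: (Suc k')
    define X where "X = x (Suc N)"
    define W where "W n = X ^ (card (cells l) + k - card (cells n)) * schur_poly x n N" for n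
    define U where "U = (\<Union>m\<in>add_vstrip l k. remove_hstrip m) \<union>
      (\<Union>m\<in>remove_hstrip l. add_vstrip m k) \<union> (\<Union>m\<in>remove_hstrip l. add_vstrip m k')"
    have shapeH: "shape m" if "m \<in> remove_hstrip l" for m using shape_remove_hstrip[OF l that] .
    have U: "finite U" unfolding U_def
      using l by (intro finite_UnI finite_UN_I finite_add_vstrip finite_remove_hstrip)
        (auto dest: shape_add_vstrip shapeH)
    have shapeU: "shape n" if "n \<in> U" for n
      using that l unfolding U_def
      by (auto dest: shape_add_vstrip shape_remove_hstrip)
    have card_diff: "card (cells m' - cells m) = card (cells m') - card (cells m) \<and> card (cells m) \<le> card (cells m')"
      if "shape m'" "m \<in> remove_hstrip m'" for m m'
      using cells_remove_hstrip[OF that(2)] finite_cells[OF that(1)]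
        finite_cells[OF shape_remove_hstrip[OF that]]
      by (simp add: card_Diff_subset card_mono)
    have "elem x k (Suc N) * schur_poly x l (Suc N) =
        (\<Sum>m\<in>remove_hstrip l. X ^ card (cells l - cells m) * (elem x k N * schur_poly x m N)) +
        (\<Sum>m\<in>remove_hstrip l. X * X ^ card (cells l - cells m) * (elem x k' N * schur_poly x m N))"
      unfolding k elem_Suc_Suc schur_poly_Suc[OF l] X_def[symmetric] sum_distrib_left sum.distrib[symmetric]
      by (intro sum.cong refl) (simp only: distrib_left distrib_right mult.assoc mult.left_commute[of _ "X ^ _"])
    also have "(\<Sum>m\<in>remove_hstrip l. X ^ card (cells l - cells m) * (elem x k N * schur_poly x m N)) =
        (\<Sum>m\<in>remove_hstrip l. \<Sum>n\<in>add_vstrip m k. W n)"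
    proof (intro sum.cong refl)
      fix m assume m: "m \<in> remove_hstrip l"
      have "W n = X ^ card (cells l - cells m) * schur_poly x n N" if "n \<in> add_vstrip m k" for n
        using card_diff[OF l m] card_cells_add_vstrip[OF shapeH[OF m] that] by (simp add: W_def)
      then show "X ^ card (cells l - cells m) * (elem x k N * schur_poly x m N) =
          (\<Sum>n\<in>add_vstrip m k. W n)"
        by (simp add: Suc.IH[OF shapeH[OF m]] sum_distrib_left)
    qed
    also have "(\<Sum>m\<in>remove_hstrip l. X * X ^ card (cells l - cells m) * (elem x k' N * schur_poly x m N)) =
        (\<Sum>m\<in>remove_hstrip l. \<Sum>n\<in>add_vstrip m k'. W n)"
    proof (intro sum.cong refl)
      fix m assume m: "m \<in> remove_hstrip l"
      have "W n = X * X ^ card (cells l - cells m) * schur_poly x n N" if "n \<in> add_vstrip m k'" for n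
      proof -
        have "card (cells l) + k - card (cells n) = Suc (card (cells l - cells m))"
          using card_diff[OF l m] card_cells_add_vstrip[OF shapeH[OF m] that] k by (simp add: Suc_diff_le)
        then show ?thesis by (simp add: W_def)
      qed
      then show "X * X ^ card (cells l - cells m) * (elem x k' N * schur_poly x m N) =
          (\<Sum>n\<in>add_vstrip m k'. W n)"
        by (simp add: Suc.IH[OF shapeH[OF m]] sum_distrib_left)
    qed
    also have "(\<Sum>m\<in>remove_hstrip l. \<Sum>n\<in>add_vstrip m k. W n) + (\<Sum>m\<in>remove_hstrip l. \<Sum>n\<in>add_vstrip m k'. W n) =
        (\<Sum>n\<in>U. of_nat (card {m \<in> add_vstrip l k. n \<in> remove_hstrip m}) * W n)"
    proof -
      have "(\<Sum>m\<in>remove_hstrip l. \<Sum>n\<in>add_vstrip m k. W n) =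
          (\<Sum>n\<in>U. of_nat (card {m \<in> remove_hstrip l. n \<in> add_vstrip m k}) * W n)"
        by (rule sum_pairs_by_second[OF finite_remove_hstrip[OF l] U]) (auto simp: U_def)
      moreover have "(\<Sum>m\<in>remove_hstrip l. \<Sum>n\<in>add_vstrip m k'. W n) =
          (\<Sum>n\<in>U. of_nat (card {m \<in> remove_hstrip l. n \<in> add_vstrip m k'}) * W n)"
        by (rule sum_pairs_by_second[OF finite_remove_hstrip[OF l] U]) (auto simp: U_def)
      moreover have "of_nat (card {m \<in> add_vstrip l k. n \<in> remove_hstrip m}) * W n =
          of_nat (card {m \<in> remove_hstrip l. n \<in> add_vstrip m k}) * W n +
          of_nat (card {m \<in> remove_hstrip l. n \<in> add_vstrip m k'}) * W n" if "n \<in> U" for n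
        unfolding k card_up_down_strips[OF l shapeU[OF that]] by (simp add: distrib_right)
      ultimately show ?thesis by (simp add: sum.distrib)
    qed
    also have "\<dots> = (\<Sum>m\<in>add_vstrip l k. \<Sum>n\<in>remove_hstrip m. W n)"
      by (rule sum_pairs_by_second[OF finite_add_vstrip[OF l] U, symmetric]) (auto simp: U_def)
    also have "\<dots> = (\<Sum>m\<in>add_vstrip l k. schur_poly x m (Suc N))"
    proof (intro sum.cong refl)
      fix m assume m: "m \<in> add_vstrip l k"
      have "W n = X ^ card (cells m - cells n) * schur_poly x n N" if "n \<in> remove_hstrip m" for n
        using card_diff[OF shape_add_vstrip[OF m] that] card_cells_add_vstrip[OF l m]
        by (simp add: W_def)
      then show "(\<Sum>n\<in>remove_hstrip m. W n) = schur_poly x m (Suc N)"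
        by (simp add: schur_poly_Suc[OF shape_add_vstrip[OF m]] X_def)
    qed
    finally show ?thesis .
  qed
qed

section \<open>Schur positive families of polynomials\<close>

text \<open>
  The members of the family \<open>f\<close> are polynomials in \<open>x 1, \<dots>, x N\<close> for varying \<open>N\<close>; the expansion
  into Schur polynomials must not depend on \<open>N\<close>.
\<close>

definition schur_pos :: "(nat \<Rightarrow> 'a::comm_ring_1) \<Rightarrow> (nat \<Rightarrow> 'a) \<Rightarrow> bool" where
  "schur_pos x f \<longleftrightarrow>
     (\<exists>M. (\<forall>l\<in>#M. shape l) \<and> (\<forall>N. f N = (\<Sum>l\<in>#M. schur_poly x l N)))"

lemma schur_pos_zero: "schur_pos x (\<lambda>N. 0)"
  unfolding schur_pos_def by (intro exI[of _ "{#}"]) simp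

lemma schur_pos_schur_poly: "shape l \<Longrightarrow> schur_pos x (schur_poly x l)"
  unfolding schur_pos_def by (intro exI[of _ "{#l#}"]) simp

lemma shape_empty: "shape (\<lambda>_. 0)"
  by (simp add: shape_def)

lemma schur_pos_one: "schur_pos x (\<lambda>N. 1)"
  using schur_pos_schur_poly[OF shape_empty, of x] by (simp add: schur_poly_empty[abs_def])

lemma schur_pos_add:
  assumes "schur_pos x f" "schur_pos x g"
  shows "schur_pos x (\<lambda>N. f N + g N)"
proof -
  obtain M M' where "\<forall>l\<in>#M. shape l" "\<forall>N. f N = (\<Sum>l\<in>#M. schur_poly x l N)"
    and "\<forall>l\<in>#M'. shape l" "\<forall>N. g N = (\<Sum>l\<in>#M'. schur_poly x l N)"
    using assms unfolding schur_pos_def by blast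
  then show ?thesis unfolding schur_pos_def by (intro exI[of _ "M + M'"]) auto
qed

lemma schur_pos_sum:
  "(\<And>i. i \<in> I \<Longrightarrow> schur_pos x (f i)) \<Longrightarrow> schur_pos x (\<lambda>N. \<Sum>i\<in>I. f i N)"
  by (induction I rule: infinite_finite_induct) (auto intro: schur_pos_zero schur_pos_add)

lemma schur_pos_of_nat_mult: "schur_pos x f \<Longrightarrow> schur_pos x (\<lambda>N. of_nat k * f N)"
  by (induction k) (auto simp: distrib_right intro: schur_pos_zero schur_pos_add)

lemma schur_pos_elem_mult:
  assumes "schur_pos x f"
  shows "schur_pos x (\<lambda>N. elem x k N * f N)"
proof -
  obtain M where M: "\<forall>l\<in>#M. shape l" "\<forall>N. f N = (\<Sum>l\<in>#M. schur_poly x l N)"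
    using assms unfolding schur_pos_def by blast
  have "schur_pos x (\<lambda>N. elem x k N * (\<Sum>l\<in>#M. schur_poly x l N))"
    using M(1)
  proof (induction M)
    case empty
    then show ?case by (simp add: schur_pos_zero)
  next
    case (add l M)
    then have "schur_pos x (\<lambda>N. elem x k N * schur_poly x l N)"
      by (simp add: dual_Pieri schur_pos_sum schur_pos_schur_poly shape_add_vstrip)
    with add show ?case by (simp add: distrib_left schur_pos_add)
  qed
  then show ?thesis using M(2) by simp
qed

section \<open>Elementary polynomials as one-column Schur polynomials; the differences s_21 and
  s_22\<close>

definition column :: "nat \<Rightarrow> nat \<Rightarrow> nat" where
  "column k = (\<lambda>i. of_bool (i < k))"

lemma shape_column: "shape (column k)"
  by (auto simp: shape_def column_def intro: finite_subset[of _ "{..<k}"])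

lemma add_vstrip_empty: "add_vstrip (\<lambda>_. 0) k = {column k}"
proof (intro equalityI subsetI)
  fix m assume "m \<in> add_vstrip (\<lambda>_. 0) k"
  then obtain S where S: "finite S" "card S = k" and m: "m = add_boxes (\<lambda>_. 0) S" "shape m"
    by (auto simp: add_vstrip_def)
  have "j' \<in> S" if "j \<in> S" "j' \<le> j" for j j'
    using shape_antimono[OF m(2) that(2)] that(1) by (auto simp: m(1) add_boxes_def of_bool_def split: if_splits)
  with S(1) have "S = {..<card S}" by (rule down_closed_eq_lessThan)
  then have "\<And>i. i \<in> S \<longleftrightarrow> i < k" using S(2) by (metis lessThan_iff)
  then show "m \<in> {column k}" by (simp add: m(1) add_boxes_def column_def)
next
  fix m assume m: "m \<in> {column k}"
  show "m \<in> add_vstrip (\<lambda>_. 0) k"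
    unfolding add_vstrip_def
    by (intro CollectI exI[of _ "{..<k}"]) (use m in \<open>simp add: shape_column, simp add: add_boxes_def column_def\<close>)
qed

lemma elem_eq_schur_poly: "elem x k N = schur_poly x (column k) N"
  using dual_Pieri[OF shape_empty, of x k N] by (simp add: schur_poly_empty add_vstrip_empty)

text \<open>The Pieri expansion is a sum over a set of shapes, each with coefficient 1, so
  subtracting some of its terms leaves the others.\<close>

lemma schur_pos_Pieri_diff:
  assumes "shape l" "A \<subseteq> add_vstrip l k"
  shows "schur_pos x (\<lambda>N. elem x k N * schur_poly x l N - (\<Sum>m\<in>A. schur_poly x m N))"
proof -
  have "schur_pos x (\<lambda>N. \<Sum>m\<in>add_vstrip l k - A. schur_poly x m N)"
    by (intro schur_pos_sum schur_pos_schur_poly) (auto intro: shape_add_vstrip)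
  then show ?thesis
    using assms by (simp add: dual_Pieri sum_diff finite_add_vstrip)
qed

lemma schur_pos_e1e2_e3: "schur_pos x (\<lambda>N. elem x 1 N * elem x 2 N - elem x 3 N)"
proof -
  have "column 3 = add_boxes (column 2) {2}"
    by (auto simp: column_def add_boxes_def fun_eq_iff)
  then have "{column 3} \<subseteq> add_vstrip (column 2) 1"
    using shape_column[of 3] by (auto simp: add_vstrip_def intro!: exI[of _ "{2}"])
  from schur_pos_Pieri_diff[OF shape_column this, of x] show ?thesis
    by (simp add: elem_eq_schur_poly)
qed

lemma schur_pos_e2e2_e1e3: "schur_pos x (\<lambda>N. elem x 2 N * elem x 2 N - elem x 1 N * elem x 3 N)"
proof -
  have "add_vstrip (column 3) 1 \<subseteq> add_vstrip (column 2) 2"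
  proof
    fix m assume "m \<in> add_vstrip (column 3) 1"
    then obtain r where m: "m = add_boxes (column 3) {r}" "shape m"
      by (auto simp: add_vstrip_def card_1_singleton_iff)
    \<comment> \<open>A second box in row 2 would make it longer than row 1. So the box r and the
      bottom box of the column of height 3 lie in distinct rows and form a vertical strip on the
      column of height 2.\<close>
    have "m 2 \<le> m 1" using shape_antimono[OF m(2)] by simp
    then have "r \<noteq> 2" by (auto simp: m(1) add_boxes_def column_def)
    then have "m = add_boxes (column 2) {2, r}" "card {2, r} = 2"
      by (auto simp: m(1) column_def add_boxes_def fun_eq_iff)
    then show "m \<in> add_vstrip (column 2) 2"
      unfolding add_vstrip_def using m(2) by (intro CollectI exI[of _ "{2, r}"]) simp
  qed
  from schur_pos_Pieri_diff[OF shape_column this, of x] show ?thesis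
    by (simp only: elem_eq_schur_poly dual_Pieri[OF shape_column, symmetric])
qed

section \<open>Path polynomials\<close>

text \<open>
  \<open>leg_poly x N k c\<close> enumerates the proper colorings of a leg with \<open>k\<close> vertices attached to a
  vertex with color \<open>c\<close>.
\<close>

primrec leg_poly :: "(nat \<Rightarrow> 'a::comm_ring_1) \<Rightarrow> nat \<Rightarrow> nat \<Rightarrow> nat \<Rightarrow> 'a" where
  "leg_poly x N 0 = (\<lambda>c. 1)"
| "leg_poly x N (Suc k) = (\<lambda>c. \<Sum>y\<in>{1..N} - {c}. x y * leg_poly x N k y)"

definition path_poly :: "(nat \<Rightarrow> 'a::comm_ring_1) \<Rightarrow> nat \<Rightarrow> nat \<Rightarrow> 'a" where
  "path_poly x k N = (case k of 0 \<Rightarrow> 1 | Suc k \<Rightarrow> \<Sum>y\<in>{1..N}. x y * leg_poly x N k y)"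

lemma path_poly_0 [simp]: "path_poly x 0 N = 1"
  by (simp add: path_poly_def)

lemma path_poly_Suc: "path_poly x (Suc k) N = (\<Sum>y\<in>{1..N}. x y * leg_poly x N k y)"
  by (simp add: path_poly_def)

lemma leg_poly_Suc_diff:
  "c \<in> {1..N} \<Longrightarrow> leg_poly x N (Suc k) c = path_poly x (Suc k) N - x c * leg_poly x N k c"
  by (simp add: path_poly_Suc sum_diff1)

declare leg_poly.simps(2) [simp del]

text \<open>Both sides color a path with a + b + 1 vertices, the left one sorted by the color of the
  vertex with a vertices on one side and b on the other. The induction moves one vertex
  across.\<close>

lemma sum_leg_poly_mult:
  "(\<Sum>c\<in>{1..N}. x c * leg_poly x N a c * leg_poly x N b c) = path_poly x (Suc (a + b)) N"
proof (induction b arbitrary: a)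
  case 0
  then show ?case by (simp add: path_poly_Suc)
next
  case (Suc b)
  have "(\<Sum>c\<in>{1..N}. x c * leg_poly x N a c * leg_poly x N (Suc b) c) =
      (\<Sum>c\<in>{1..N}. path_poly x (Suc b) N * (x c * leg_poly x N a c) -
        x c * x c * leg_poly x N a c * leg_poly x N b c)"
    by (intro sum.cong refl) (simp add: leg_poly_Suc_diff algebra_simps)
  \<comment> \<open>The first part sums to P_(a+1) P_(b+1) before and after, which is symmetric in a
    and b.\<close>
  also have "\<dots> = (\<Sum>c\<in>{1..N}. path_poly x (Suc a) N * (x c * leg_poly x N b c) -
        x c * x c * leg_poly x N a c * leg_poly x N b c)"
    unfolding sum_subtractf sum_distrib_left[symmetric] path_poly_Suc[symmetric]
    by (simp only: mult.commute)
  also have "\<dots> = (\<Sum>c\<in>{1..N}. x c * leg_poly x N (Suc a) c * leg_poly x N b c)"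
    by (intro sum.cong refl) (simp add: leg_poly_Suc_diff algebra_simps)
  also have "\<dots> = path_poly x (Suc (a + Suc b)) N" using Suc.IH[of "Suc a"] by simp
  finally show ?case .
qed

text \<open>
  The relation \<open>leg_poly 3 = path_poly 3 - x c * leg_poly 2\<close> replaces the two short legs by one
  of length three.
\<close>

lemma sum_leg_poly_spider:
  "(\<Sum>c\<in>{1..N}. x c * leg_poly x N a c * leg_poly x N 2 c * leg_poly x N 1 c) =
     path_poly x (a + 4) N + path_poly x 1 N * path_poly x (a + 3) N - path_poly x 3 N * path_poly x (a + 1) N"
proof -
  have "(\<Sum>c\<in>{1..N}. x c * leg_poly x N a c * leg_poly x N 2 c * leg_poly x N 1 c) =
      (\<Sum>c\<in>{1..N}. x c * leg_poly x N a c * leg_poly x N 3 c +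
         path_poly x 1 N * (x c * leg_poly x N a c * leg_poly x N 2 c) -
         path_poly x 3 N * (x c * leg_poly x N a c * leg_poly x N 0 c))"
  proof (intro sum.cong refl)
    fix c assume c: "c \<in> {1..N}"
    have l1: "leg_poly x N 1 c = path_poly x 1 N - x c"
      using leg_poly_Suc_diff[OF c, of x 0] by simp
    have l3: "leg_poly x N 3 c = path_poly x 3 N - x c * leg_poly x N 2 c"
      using leg_poly_Suc_diff[OF c, of x 2] by simp
    show "x c * leg_poly x N a c * leg_poly x N 2 c * leg_poly x N 1 c =
        x c * leg_poly x N a c * leg_poly x N 3 c +
         path_poly x 1 N * (x c * leg_poly x N a c * leg_poly x N 2 c) -
         path_poly x 3 N * (x c * leg_poly x N a c * leg_poly x N 0 c)"
      unfolding l1 l3 by (simp add: algebra_simps)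
  qed
  then show ?thesis
    by (simp only: sum.distrib sum_subtractf sum_distrib_left[symmetric] sum_leg_poly_mult)
      (simp add: numeral_eq_Suc)
qed

section \<open>Generating functions of paths\<close>

definition path_gf :: "(nat \<Rightarrow> 'a::comm_ring_1) \<Rightarrow> nat \<Rightarrow> 'a fps" where
  "path_gf x N = Abs_fps (\<lambda>k. path_poly x k N)"

text \<open>Truncated subtraction makes the constant coefficient 0 and not -1, so that
  \<open>1 - loop_gf x N\<close> equals E - z E' in every degree.\<close>

definition loop_gf :: "(nat \<Rightarrow> 'a::comm_ring_1) \<Rightarrow> nat \<Rightarrow> 'a fps" where
  "loop_gf x N = Abs_fps (\<lambda>i. of_nat (i - 1) * elem x i N)"

lemma fps_deriv_prod_linear:
  fixes x :: "'b \<Rightarrow> 'a::comm_ring_1"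
  assumes "finite A"
  shows "fps_deriv (\<Prod>c\<in>A. 1 + fps_const (x c) * fps_X) =
    (\<Sum>c\<in>A. fps_const (x c) * (\<Prod>d\<in>A - {c}. 1 + fps_const (x d) * fps_X))"
  using assms
proof (induction A)
  case (insert a A)
  let ?g = "\<lambda>d. 1 + fps_const (x d) * fps_X"
  have "(\<Prod>d\<in>insert a A - {c}. ?g d) = ?g a * (\<Prod>d\<in>A - {c}. ?g d)" if "c \<in> A" for c
  proof -
    have "insert a A - {c} = insert a (A - {c})" using that insert.hyps by auto
    then show ?thesis using insert.hyps by simp
  qed
  moreover have "insert a A - {a} = A" using insert.hyps by auto
  ultimately show ?case
    using insert by (simp add: sum_distrib_left mult.left_commute)
qed simp

text \<open>The generating function of legs at color c is P / (1 + x_c z). Sorting paths by the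
  color of an end vertex gives P = 1 + z P E'/E; multiplying by E avoids division.\<close>

lemma path_gf_equation: "path_gf x N * (1 - loop_gf x N) = elem_gf x N"
proof -
  define leg where "leg c = Abs_fps (\<lambda>k. leg_poly x N k c)" for c
  define g where "g c = 1 + fps_const (x c) * fps_X" for c
  let ?E = "elem_gf x N" and ?P = "path_gf x N"
  have E: "?E = prod g {1..N}" by (simp add: elem_gf_def g_def)
  have leg: "g c * leg c = ?P" if "c \<in> {1..N}" for c
  proof (rule fps_ext)
    fix n
    show "fps_nth (g c * leg c) n = fps_nth ?P n"
      using leg_poly_Suc_diff[OF that, of x]
      by (cases n) (simp_all add: g_def leg_def path_gf_def distrib_right mult.assoc)
  qed
  have P: "?P = 1 + fps_X * (\<Sum>c\<in>{1..N}. fps_const (x c) * leg c)"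
  proof (rule fps_ext)
    fix n
    show "fps_nth ?P n = fps_nth (1 + fps_X * (\<Sum>c\<in>{1..N}. fps_const (x c) * leg c)) n"
      by (cases n) (simp_all add: path_gf_def path_poly_Suc fps_sum_nth leg_def)
  qed
  have E_leg: "?E * leg c = prod g ({1..N} - {c}) * ?P" if "c \<in> {1..N}" for c
  proof -
    have "prod g {1..N} = g c * prod g ({1..N} - {c})" using that by (intro prod.remove) auto
    then show ?thesis unfolding E leg[OF that, symmetric] by (simp add: ac_simps)
  qed
  have dE: "fps_deriv ?E = (\<Sum>c\<in>{1..N}. fps_const (x c) * prod g ({1..N} - {c}))"
    unfolding elem_gf_def g_def by (rule fps_deriv_prod_linear) simp
  have "?E * (\<Sum>c\<in>{1..N}. fps_const (x c) * leg c) = fps_deriv ?E * ?P"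
    unfolding dE sum_distrib_left sum_distrib_right
  proof (rule sum.cong)
    fix c assume "c \<in> {1..N}"
    then show "?E * (fps_const (x c) * leg c) = fps_const (x c) * prod g ({1..N} - {c}) * ?P"
      by (simp only: mult.left_commute[of ?E] E_leg mult.assoc)
  qed simp
  then have EP: "?E * ?P = ?E + fps_X * (fps_deriv ?E * ?P)"
    by (subst P) (simp add: distrib_left mult.left_commute)
  have "1 - loop_gf x N = ?E - fps_X * fps_deriv ?E"
  proof (rule fps_ext)
    fix n
    show "fps_nth (1 - loop_gf x N) n = fps_nth (?E - fps_X * fps_deriv ?E) n"
      using elem_0[of x N]
      by (cases n) (simp_all add: loop_gf_def elem_def algebra_simps)
  qed
  then have "?P * (1 - loop_gf x N) = ?E * ?P - fps_X * (fps_deriv ?E * ?P)"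
    by (simp only: right_diff_distrib ac_simps)
  then show ?thesis by (simp add: EP)
qed

text \<open>The coefficients of the inverse of \<open>1 - loop_gf x N\<close>.\<close>

fun comp_poly :: "(nat \<Rightarrow> 'a::comm_ring_1) \<Rightarrow> nat \<Rightarrow> nat \<Rightarrow> 'a" where
  "comp_poly x 0 N = 1"
| "comp_poly x (Suc n) N = (\<Sum>i\<le>n. of_nat i * (elem x (Suc i) N * comp_poly x (n - i) N))"

declare comp_poly.simps(2) [simp del]

lemma comp_gf_equation: "(1 - loop_gf x N) * Abs_fps (\<lambda>n. comp_poly x n N) = 1"
proof -
  have "Abs_fps (\<lambda>n. comp_poly x n N) = 1 + loop_gf x N * Abs_fps (\<lambda>n. comp_poly x n N)"
  proof (rule fps_ext)
    fix n
    show "fps_nth (Abs_fps (\<lambda>n. comp_poly x n N)) n =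
        fps_nth (1 + loop_gf x N * Abs_fps (\<lambda>n. comp_poly x n N)) n"
      by (cases n) (simp_all add: fps_mult_nth loop_gf_def comp_poly.simps(2) atLeast0AtMost
          sum.atMost_Suc_shift mult.assoc del: sum.atMost_Suc)
  qed
  then show ?thesis unfolding left_diff_distrib mult_1_left by (simp only: diff_eq_eq)
qed

lemma path_poly_comp: "path_poly x n N = (\<Sum>i\<le>n. elem x i N * comp_poly x (n - i) N)"
proof -
  have "path_gf x N = elem_gf x N * Abs_fps (\<lambda>n. comp_poly x n N)"
    by (simp add: path_gf_equation[symmetric] mult.assoc comp_gf_equation)
  from arg_cong[OF this, of "\<lambda>f. fps_nth f n"] show ?thesis
    by (simp add: path_gf_def fps_mult_nth elem_def atLeast0AtMost)
qed

text \<open>The same identity without inverting the denominator. It expands the long paths and keeps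
  shorter paths as factors, while \<open>path_poly_comp\<close> resolves those that take part in the
  cancellation.\<close>

lemma path_poly_rec:
  "path_poly x (Suc n) N = elem x (Suc n) N + (\<Sum>i\<le>n. of_nat i * (elem x (Suc i) N * path_poly x (n - i) N))"
proof -
  have "path_gf x N = elem_gf x N + loop_gf x N * path_gf x N"
    using path_gf_equation[of x N] by (simp add: algebra_simps)
  from arg_cong[OF this, of "\<lambda>f. fps_nth f (Suc n)"] show ?thesis
    by (simp add: path_gf_def loop_gf_def fps_mult_nth elem_def atLeast0AtMost
        sum.atMost_Suc_shift mult.assoc del: sum.atMost_Suc)
qed

text \<open>Only multiplication by \<open>elem\<close> is known to preserve
  \<open>schur_pos\<close>; the recursion of \<open>comp_poly\<close> has nonnegative coefficients
  and reduces to that case.\<close>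

lemma schur_pos_comp_mult:
  "schur_pos x f \<Longrightarrow> schur_pos x (\<lambda>N. comp_poly x n N * f N)"
proof (induction n arbitrary: f rule: less_induct)
  case (less n)
  show ?case
  proof (cases n)
    case 0
    then show ?thesis using less.prems by simp
  next
    case (Suc k)
    have "schur_pos x (\<lambda>N. \<Sum>i\<le>k. of_nat i * (elem x (Suc i) N * (comp_poly x (k - i) N * f N)))"
      by (intro schur_pos_sum schur_pos_of_nat_mult schur_pos_elem_mult less) (use Suc in auto)
    then show ?thesis by (simp add: Suc comp_poly.simps(2) sum_distrib_right mult.assoc)
  qed
qed

lemma schur_pos_path_poly: "schur_pos x (path_poly x n)"
proof -
  have "schur_pos x (\<lambda>N. \<Sum>i\<le>n. elem x i N * (comp_poly x (n - i) N * 1))"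
    by (intro schur_pos_sum schur_pos_elem_mult schur_pos_comp_mult schur_pos_one)
  then show ?thesis by (simp add: path_poly_comp[abs_def])
qed

lemma path_poly_1: "path_poly x 1 N = elem x 1 N"
  using path_poly_rec[of x 0 N] by simp

lemma path_poly_3: "path_poly x 3 N = 3 * elem x 3 N + elem x 1 N * elem x 2 N"
proof -
  have "path_poly x 3 N = elem x 3 N + (\<Sum>i\<le>2. of_nat i * (elem x (Suc i) N * path_poly x (2 - i) N))"
    using path_poly_rec[of x 2 N] by (simp add: numeral_3_eq_3)
  also have "{..2::nat} = {0, 1, 2}" by auto
  finally show ?thesis using path_poly_1[of x N] by (simp add: numeral_3_eq_3 numeral_2_eq_2 algebra_simps)
qed

lemma path_poly_comp_2:
  "path_poly x (k + 2) N = comp_poly x (k + 2) N + elem x 1 N * comp_poly x (k + 1) N +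
     elem x 2 N * comp_poly x k N + (\<Sum>i<k. elem x (i + 3) N * comp_poly x (k - Suc i) N)"
  by (simp add: path_poly_comp sum.atMost_Suc_shift sum.atMost_shift[of _ k] eval_nat_numeral add.assoc del: sum.atMost_Suc)

lemma path_poly_comp_3:
  "path_poly x (k + 3) N = comp_poly x (k + 3) N + elem x 1 N * comp_poly x (k + 2) N +
     elem x 2 N * comp_poly x (k + 1) N + elem x 3 N * comp_poly x k N +
     (\<Sum>i<k. elem x (i + 4) N * comp_poly x (k - Suc i) N)"
  by (simp add: path_poly_comp sum.atMost_Suc_shift sum.atMost_shift[of _ k] eval_nat_numeral add.assoc del: sum.atMost_Suc)

text \<open>The terms with P_1 and P_0 are split off, so that every path left under the sum has
  index at least 2 and \<open>path_poly_comp_2\<close> applies to it.\<close>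

lemma path_poly_rec_4:
  "path_poly x (k + 4) N = elem x (k + 4) N + elem x 2 N * path_poly x (k + 2) N +
     (\<Sum>i<k. of_nat (i + 2) * (elem x (i + 3) N * path_poly x (k - Suc i + 2) N)) +
     of_nat (k + 2) * (elem x (k + 3) N * elem x 1 N) + of_nat (k + 3) * elem x (k + 4) N"
proof -
  have "path_poly x (k + 4) N = elem x (k + 4) N + elem x 2 N * path_poly x (k + 2) N +
     (\<Sum>i\<le>Suc k. of_nat (i + 2) * (elem x (i + 3) N * path_poly x (Suc k - i) N))"
    using path_poly_rec[of x "k + 3" N]
    by (simp add: sum.atMost_Suc_shift eval_nat_numeral add.assoc del: sum.atMost_Suc)
  also have "(\<Sum>i\<le>Suc k. of_nat (i + 2) * (elem x (i + 3) N * path_poly x (Suc k - i) N)) =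
     (\<Sum>i<k. of_nat (i + 2) * (elem x (i + 3) N * path_poly x (Suc k - i) N)) +
     of_nat (k + 2) * (elem x (k + 3) N * elem x 1 N) + of_nat (k + 3) * elem x (k + 4) N"
    using path_poly_1[of x N] by (simp add: lessThan_Suc_atMost[symmetric] eval_nat_numeral)
  also have "(\<Sum>i<k. of_nat (i + 2) * (elem x (i + 3) N * path_poly x (Suc k - i) N)) =
     (\<Sum>i<k. of_nat (i + 2) * (elem x (i + 3) N * path_poly x (k - Suc i + 2) N))"
  proof (rule sum.cong)
    fix i assume "i \<in> {..<k}"
    then have "Suc k - i = k - Suc i + 2" by simp
    then show "of_nat (i + 2) * (elem x (i + 3) N * path_poly x (Suc k - i) N) =
        of_nat (i + 2) * (elem x (i + 3) N * path_poly x (k - Suc i + 2) N)" by simp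
  qed simp
  finally show ?thesis by (simp add: add.assoc)
qed

lemma path_poly_rec_5:
  "path_poly x (k + 5) N = elem x (k + 5) N + elem x 2 N * path_poly x (k + 3) N +
     2 * (elem x 3 N * path_poly x (k + 2) N) +
     (\<Sum>i\<le>k+1. of_nat (i + 3) * (elem x (i + 4) N * path_poly x (k + 1 - i) N))"
  using path_poly_rec[of x "k + 4" N]
  by (simp add: sum.atMost_Suc_shift eval_nat_numeral add.assoc del: sum.atMost_Suc)

text \<open>
  After expanding by \<open>path_poly_rec\<close>, the only negative term is \<open>e\<^sub>3 P\<^bsub>k+2\<^esub>\<close>.  In its expansion
  by \<open>path_poly_comp\<close>, the terms with \<open>e\<^sub>0\<close>, \<open>e\<^sub>1\<close>, \<open>e\<^sub>2\<close> are absorbed by \<open>e\<^sub>2 P\<^bsub>k+3\<^esub>\<close>, leaving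
  \<open>e\<^sub>1 e\<^sub>2 - e\<^sub>3\<close>, \<open>e\<^sub>2 e\<^sub>2 - e\<^sub>1 e\<^sub>3\<close> and \<open>0\<close>; the terms with \<open>e\<^sub>i\<close>, \<open>i \<ge> 3\<close>, are absorbed by
  \<open>e\<^sub>1 (i - 1) e\<^sub>i P\<^bsub>k+4-i\<^esub>\<close>, which contributes \<open>e\<^sub>1 e\<^sub>2 e\<^sub>i\<close>.
\<close>

lemma schur_pos_path_combination:
  "schur_pos x (\<lambda>N. path_poly x (k + 5) N + path_poly x 1 N * path_poly x (k + 4) N -
     path_poly x 3 N * path_poly x (k + 2) N)"
proof -
  define e where "e i N = elem x i N" for i N
  define D where "D i N = comp_poly x i N" for i N
  define P where "P i N = path_poly x i N" for i N
  \<comment> \<open>The tail of P_(j+2) in \<open>path_poly_comp_2\<close>. Trailing factors 1 give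
    each product the form \<open>e i N * f N\<close> or \<open>D i N * f N\<close> that the
    positivity rules match.\<close>
  define R where "R j N = (\<Sum>i<j. e (i + 3) N * (D (j - Suc i) N * 1))" for j N
  \<comment> \<open>Of the i + 2 copies of e_1 e_2 e_(i+3) D_(k-1-i), one is spent on e_3 e_(i+3)
    D_(k-1-i) and becomes a multiple of e_1 e_2 - e_3; i + 1 copies remain.\<close>
  define F where "F i N = of_nat (i + 2) * (e 1 N * (e (i + 3) N *
        (D (k - Suc i + 2) N * 1 + e 1 N * (D (k - Suc i + 1) N * 1) + R (k - Suc i) N))) +
      of_nat (i + 1) * (e 1 N * (e 2 N * (e (i + 3) N * (D (k - Suc i) N * 1)))) +
      e (i + 3) N * (D (k - Suc i) N * (e 1 N * e 2 N - e 3 N))" for i N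
  have mults: "schur_pos x (\<lambda>N. e i N * f N)" "schur_pos x (\<lambda>N. D i N * f N)"
    if "schur_pos x f" for i f
    using that by (auto simp: e_def D_def intro: schur_pos_elem_mult schur_pos_comp_mult)
  have P: "schur_pos x (P i)" for i
    using schur_pos_path_poly[of x i] by (simp add: P_def[abs_def])
  have s21: "schur_pos x (\<lambda>N. e 1 N * e 2 N - e 3 N)"
    and s22: "schur_pos x (\<lambda>N. e 2 N * e 2 N - e 1 N * e 3 N)"
    using schur_pos_e1e2_e3[of x] schur_pos_e2e2_e1e3[of x] by (simp_all add: e_def)
  note intros = schur_pos_add schur_pos_sum schur_pos_of_nat_mult mults schur_pos_one P s21 s22
  have R: "schur_pos x (R j)" for j
    unfolding R_def[abs_def] by (intro intros)
  have F: "schur_pos x (F i)" for i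
    unfolding F_def[abs_def] by (intro intros R)
  have "schur_pos x (\<lambda>N. e (k + 5) N * 1 + e 1 N * (e (k + 4) N * 1) + e 2 N * (D (k + 3) N * 1) +
      D (k + 2) N * (e 1 N * e 2 N - e 3 N) + D (k + 1) N * (e 2 N * e 2 N - e 1 N * e 3 N) +
      e 2 N * (\<Sum>i<k. e (i + 4) N * (D (k - Suc i) N * 1)) +
      (\<Sum>i\<le>k+1. of_nat (i + 3) * (e (i + 4) N * P (k + 1 - i) N)) +
      of_nat (k + 2) * (e 1 N * (e (k + 3) N * (e 1 N * 1))) +
      of_nat (k + 3) * (e 1 N * (e (k + 4) N * 1)) + (\<Sum>i<k. F i N))"
    by (intro intros F)
  also have "(\<lambda>N. e (k + 5) N * 1 + e 1 N * (e (k + 4) N * 1) + e 2 N * (D (k + 3) N * 1) +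
      D (k + 2) N * (e 1 N * e 2 N - e 3 N) + D (k + 1) N * (e 2 N * e 2 N - e 1 N * e 3 N) +
      e 2 N * (\<Sum>i<k. e (i + 4) N * (D (k - Suc i) N * 1)) +
      (\<Sum>i\<le>k+1. of_nat (i + 3) * (e (i + 4) N * P (k + 1 - i) N)) +
      of_nat (k + 2) * (e 1 N * (e (k + 3) N * (e 1 N * 1))) +
      of_nat (k + 3) * (e 1 N * (e (k + 4) N * 1)) + (\<Sum>i<k. F i N)) =
    (\<lambda>N. P (k + 5) N + P 1 N * P (k + 4) N - P 3 N * P (k + 2) N)"
  proof (rule HOL.ext)
    fix N
    define A where "A = (\<Sum>i\<le>k+1. of_nat (i + 3) * (e (i + 4) N * P (k + 1 - i) N))"
    define B where "B = (\<Sum>i<k. of_nat (i + 2) * (e (i + 3) N * P (k - Suc i + 2) N))"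
    define S where "S = (\<Sum>i<k. e (i + 4) N * D (k - Suc i) N)"
    have "e 1 N * (of_nat (i + 2) * (e (i + 3) N * P (k - Suc i + 2) N)) =
        F i N + e 3 N * (e (i + 3) N * D (k - Suc i) N)" for i
    proof -
      have "P (k - Suc i + 2) N = D (k - Suc i + 2) N + e 1 N * D (k - Suc i + 1) N +
          e 2 N * D (k - Suc i) N + R (k - Suc i) N"
        using path_poly_comp_2[of x "k - Suc i" N] by (simp add: P_def D_def e_def R_def)
      then show ?thesis unfolding F_def by (simp add: algebra_simps)
    qed
    then have B: "e 1 N * B = (\<Sum>i<k. F i N) + e 3 N * R k N"
      by (simp add: B_def R_def sum_distrib_left sum.distrib[symmetric] del: of_nat_add)
    have P5: "P (k + 5) N = e (k + 5) N + e 2 N * P (k + 3) N + 2 * (e 3 N * P (k + 2) N) + A"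
      using path_poly_rec_5[of x k N] by (simp add: A_def P_def e_def)
    have P4: "P (k + 4) N = e (k + 4) N + e 2 N * P (k + 2) N + B +
        of_nat (k + 2) * (e (k + 3) N * e 1 N) + of_nat (k + 3) * e (k + 4) N"
      using path_poly_rec_4[of x k N] by (simp add: B_def P_def e_def)
    have P3: "P (k + 3) N = D (k + 3) N + e 1 N * D (k + 2) N + e 2 N * D (k + 1) N + e 3 N * D k N + S"
      using path_poly_comp_3[of x k N] by (simp add: S_def P_def D_def e_def)
    have P2: "P (k + 2) N = D (k + 2) N + e 1 N * D (k + 1) N + e 2 N * D k N + R k N"
      using path_poly_comp_2[of x k N] by (simp add: R_def P_def D_def e_def)
    have p3: "P 3 N = 3 * e 3 N + e 1 N * e 2 N" and p1: "P 1 N = e 1 N"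
      using path_poly_3[of x N] path_poly_1[of x N] by (simp_all add: P_def e_def)
    have F: "(\<Sum>i<k. F i N) = e 1 N * B - e 3 N * R k N" using B by simp
    \<comment> \<open>In P_3 = 3 e_3 + e_1 e_2, two of the three e_3 cancel against 2 e_3 P_(k+2) in
      P_(k+5), and e_1 e_2 cancels against e_1 e_2 P_(k+2) in e_1 P_(k+4). One -e_3 P_(k+2) is
      left.\<close>
    have "P (k + 5) N + P 1 N * P (k + 4) N - P 3 N * P (k + 2) N =
        e (k + 5) N + e 2 N * P (k + 3) N + A + e 1 N * e (k + 4) N + e 1 N * B +
        of_nat (k + 2) * (e 1 N * (e (k + 3) N * e 1 N)) + of_nat (k + 3) * (e 1 N * e (k + 4) N) -
        e 3 N * P (k + 2) N"
      unfolding P5 P4 p3 p1 by (simp add: algebra_simps)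
    also have "\<dots> = e (k + 5) N * 1 + e 1 N * (e (k + 4) N * 1) + e 2 N * (D (k + 3) N * 1) +
      D (k + 2) N * (e 1 N * e 2 N - e 3 N) + D (k + 1) N * (e 2 N * e 2 N - e 1 N * e 3 N) +
      e 2 N * S + A + of_nat (k + 2) * (e 1 N * (e (k + 3) N * (e 1 N * 1))) +
      of_nat (k + 3) * (e 1 N * (e (k + 4) N * 1)) + (\<Sum>i<k. F i N)"
      unfolding P3 P2 F by (simp add: algebra_simps)
    finally show "e (k + 5) N * 1 + e 1 N * (e (k + 4) N * 1) + e 2 N * (D (k + 3) N * 1) +
      D (k + 2) N * (e 1 N * e 2 N - e 3 N) + D (k + 1) N * (e 2 N * e 2 N - e 1 N * e 3 N) +
      e 2 N * (\<Sum>i<k. e (i + 4) N * (D (k - Suc i) N * 1)) +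
      (\<Sum>i\<le>k+1. of_nat (i + 3) * (e (i + 4) N * P (k + 1 - i) N)) +
      of_nat (k + 2) * (e 1 N * (e (k + 3) N * (e 1 N * 1))) +
      of_nat (k + 3) * (e 1 N * (e (k + 4) N * 1)) + (\<Sum>i<k. F i N) =
      P (k + 5) N + P 1 N * P (k + 4) N - P 3 N * P (k + 2) N"
      by (simp add: S_def A_def)
  qed
  finally show ?thesis by (simp add: P_def)
qed

section \<open>Colorings of spiders\<close>

text \<open>The weight g records parts of the tree already summed out, as a function of the color of
  the vertex they hang on.\<close>

definition coloring_sum ::
  "(nat \<Rightarrow> 'a::comm_ring_1) \<Rightarrow> nat \<Rightarrow> 'v set \<Rightarrow> (('v \<Rightarrow> nat) \<Rightarrow> bool) \<Rightarrow> (('v \<Rightarrow> nat) \<Rightarrow> 'a) \<Rightarrow> 'a" where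
  "coloring_sum x N V Q g = (\<Sum>c\<in>V \<rightarrow>\<^sub>E {1..N}. of_bool (Q c) * (\<Prod>v\<in>V. x (c v)) * g c)"

lemma sum_PiE_insert:
  assumes "v \<notin> V"
  shows "(\<Sum>c\<in>insert v V \<rightarrow>\<^sub>E K. h c) = (\<Sum>c\<in>V \<rightarrow>\<^sub>E K. \<Sum>y\<in>K. h (c(v := y)))"
proof -
  have "(\<Sum>c\<in>insert v V \<rightarrow>\<^sub>E K. h c) = (\<Sum>(y, c)\<in>K \<times> (V \<rightarrow>\<^sub>E K). h (c(v := y)))"
    unfolding PiE_insert_eq
    by (subst sum.reindex[OF inj_combinator[OF assms]]) (simp add: case_prod_unfold comp_def)
  also have "\<dots> = (\<Sum>c\<in>V \<rightarrow>\<^sub>E K. \<Sum>y\<in>K. h (c(v := y)))"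
    unfolding sum.cartesian_product[symmetric] by (rule sum.swap)
  finally show ?thesis .
qed

lemma coloring_sum_leaf:
  assumes V: "finite V" "u \<in> V" "v \<notin> V"
    and Q: "\<And>c y. Q (c(v := y)) = Q c" and g: "\<And>c y. g (c(v := y)) = g c"
  shows "coloring_sum x N (insert v V) (\<lambda>c. Q c \<and> c u \<noteq> c v) (\<lambda>c. g c * leg_poly x N m (c v)) =
    coloring_sum x N V Q (\<lambda>c. g c * leg_poly x N (Suc m) (c u))"
  unfolding coloring_sum_def sum_PiE_insert[OF V(3)]
proof (rule sum.cong)
  fix c
  have uv: "u \<noteq> v" using V by auto
  have prod: "(\<Prod>w\<in>insert v V. x ((c(v := y)) w)) = x y * (\<Prod>w\<in>V. x (c w))" for y
  proof -
    have "(\<Prod>w\<in>V. x ((c(v := y)) w)) = (\<Prod>w\<in>V. x (c w))" using V(3) by (intro prod.cong) auto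
    then show ?thesis using V by simp
  qed
  have "(\<Sum>y\<in>{1..N} - {c u}. x y * leg_poly x N m y) =
      (\<Sum>y\<in>{1..N}. of_bool (c u \<noteq> y) * (x y * leg_poly x N m y))"
    by (rule sum.mono_neutral_cong_left) auto
  then show "(\<Sum>y\<in>{1..N}. of_bool (Q (c(v := y)) \<and> (c(v := y)) u \<noteq> (c(v := y)) v) *
        (\<Prod>w\<in>insert v V. x ((c(v := y)) w)) * (g (c(v := y)) * leg_poly x N m ((c(v := y)) v))) =
      of_bool (Q c) * (\<Prod>w\<in>V. x (c w)) * (g c * leg_poly x N (Suc m) (c u))"
    unfolding prod Q g leg_poly.simps(2)
    by (simp add: uv of_bool_conj sum_distrib_left ac_simps)
qed simp

text \<open>The leg is consumed from its tip towards t 0. The number m of vertices already consumed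
  grows on the way, so the induction needs it arbitrary.\<close>

lemma coloring_sum_leg:
  assumes V: "finite V" "t 0 \<in> V" and t: "inj_on t {..k}" "t ` {1..k} \<inter> V = {}"
    and Q: "\<And>c j y. j \<in> {1..k} \<Longrightarrow> Q (c(t j := y)) = Q c"
    and g: "\<And>c j y. j \<in> {1..k} \<Longrightarrow> g (c(t j := y)) = g c"
  shows "coloring_sum x N (V \<union> t ` {1..k}) (\<lambda>c. Q c \<and> (\<forall>j<k. c (t j) \<noteq> c (t (Suc j))))
      (\<lambda>c. g c * leg_poly x N m (c (t k))) =
    coloring_sum x N V Q (\<lambda>c. g c * leg_poly x N (m + k) (c (t 0)))"
  using t Q g
proof (induction k arbitrary: m)
  case 0
  then show ?case by simp
next
  case (Suc k)
  let ?v = "t (Suc k)" and ?V = "V \<union> t ` {1..k}"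
  have inj: "t j \<noteq> ?v" if "j \<le> k" for j
    using inj_onD[OF Suc.prems(1), of j "Suc k"] that by auto
  have v: "?v \<notin> ?V" using Suc.prems(2) inj by fastforce
  have u: "t k \<in> ?V" using V(2) by (cases k) auto
  have ins: "V \<union> t ` {1..Suc k} = insert ?v ?V" by (simp add: atLeastAtMostSuc_conv)
  have "coloring_sum x N (V \<union> t ` {1..Suc k}) (\<lambda>c. Q c \<and> (\<forall>j<Suc k. c (t j) \<noteq> c (t (Suc j))))
      (\<lambda>c. g c * leg_poly x N m (c ?v)) =
    coloring_sum x N (insert ?v ?V) (\<lambda>c. (Q c \<and> (\<forall>j<k. c (t j) \<noteq> c (t (Suc j)))) \<and> c (t k) \<noteq> c ?v)
      (\<lambda>c. g c * leg_poly x N m (c ?v))"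
    unfolding ins by (simp add: All_less_Suc conj_ac)
  also have "\<dots> = coloring_sum x N ?V (\<lambda>c. Q c \<and> (\<forall>j<k. c (t j) \<noteq> c (t (Suc j))))
      (\<lambda>c. g c * leg_poly x N (Suc m) (c (t k)))"
  proof (rule coloring_sum_leaf[OF _ u v])
    show "finite ?V" using V(1) by simp
    show "g (c(?v := y)) = g c" for c y by (rule Suc.prems(4)) simp
    have "(c(?v := y)) (t j) = c (t j)" "(c(?v := y)) (t (Suc j)) = c (t (Suc j))" if "j < k" for c y j
      using inj[of j] inj[of "Suc j"] that by auto
    moreover have "Q (c(?v := y)) = Q c" for c y by (rule Suc.prems(3)) simp
    ultimately show "(Q (c(?v := y)) \<and> (\<forall>j<k. (c(?v := y)) (t j) \<noteq> (c(?v := y)) (t (Suc j)))) =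
        (Q c \<and> (\<forall>j<k. c (t j) \<noteq> c (t (Suc j))))" for c y
      by (metis (no_types, lifting))
  qed
  also have "\<dots> = coloring_sum x N V Q (\<lambda>c. g c * leg_poly x N (Suc m + k) (c (t 0)))"
  proof (rule Suc.IH)
    show "inj_on t {..k}" using Suc.prems(1) by (rule inj_on_subset) auto
    have "t ` {1..k} \<subseteq> t ` {1..Suc k}" by auto
    then show "t ` {1..k} \<inter> V = {}" using Suc.prems(2) by blast
    show "Q (c(t j := y)) = Q c" if "j \<in> {1..k}" for c j y
      by (rule Suc.prems(3)) (use that in simp)
    show "g (c(t j := y)) = g c" if "j \<in> {1..k}" for c j y
      by (rule Suc.prems(4)) (use that in simp)
  qed
  finally show ?case by simp
qed

definition spider_proper :: "nat list \<Rightarrow> nat \<Rightarrow> (nat \<times> nat \<Rightarrow> nat) \<Rightarrow> bool" where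
  "spider_proper lam r c \<longleftrightarrow>
     (\<forall>i<r. \<forall>j<lam ! i. c (spider_point i j) \<noteq> c (spider_point i (Suc j)))"

lemma coloring_sum_spider_legs:
  "coloring_sum x N (insert (0, 0) (SIGMA i:{..<r}. {1..lam ! i})) (spider_proper lam r) (\<lambda>c. h (c (0, 0))) =
    (\<Sum>y\<in>{1..N}. x y * (h y * (\<Prod>i<r. leg_poly x N (lam ! i) y)))"
proof (induction r arbitrary: h)
  case 0
  have "coloring_sum x N (insert (0, 0) {}) (\<lambda>c. True) (\<lambda>c. h (c (0, 0))) = (\<Sum>y\<in>{1..N}. x y * h y)"
    unfolding coloring_sum_def by (subst sum_PiE_insert) auto
  then show ?case by (simp add: spider_proper_def)
next
  case (Suc r)
  let ?V = "insert (0, 0) (SIGMA i:{..<r}. {1..lam ! i})" and ?t = "spider_point r" and ?k = "lam ! r"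
  have fresh: "?t j \<noteq> spider_point i j'" if "j \<in> {1..?k}" "i < r" for i j j'
    using that by (auto simp: spider_point_def)
  have fresh0: "?t j \<noteq> (0, 0)" if "j \<in> {1..?k}" for j
    using that by (auto simp: spider_point_def)
  have img: "?t ` {1..?k} = {r} \<times> {1..?k}" by (auto simp: spider_point_def image_iff)
  have V: "insert (0, 0) (SIGMA i:{..<Suc r}. {1..lam ! i}) = ?V \<union> ?t ` {1..?k}"
    unfolding img by (auto simp: less_Suc_eq)
  \<comment> \<open>The factor \<open>leg_poly x N 0\<close>, which is 1, starts the peeling of the
    last leg; afterwards that leg is part of the weight h at the centre.\<close>
  have "coloring_sum x N (insert (0, 0) (SIGMA i:{..<Suc r}. {1..lam ! i})) (spider_proper lam (Suc r))
      (\<lambda>c. h (c (0, 0))) =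
    coloring_sum x N (?V \<union> ?t ` {1..?k})
      (\<lambda>c. spider_proper lam r c \<and> (\<forall>j<?k. c (?t j) \<noteq> c (?t (Suc j))))
      (\<lambda>c. h (c (0, 0)) * leg_poly x N 0 (c (?t ?k)))"
    unfolding V by (simp add: spider_proper_def[abs_def] All_less_Suc conj_ac)
  also have "\<dots> = coloring_sum x N ?V (spider_proper lam r)
      (\<lambda>c. h (c (0, 0)) * leg_poly x N (0 + ?k) (c (?t 0)))"
  proof (rule coloring_sum_leg)
    show "finite ?V" by simp
    show "?t 0 \<in> ?V" by (simp add: spider_point_def)
    show "inj_on ?t {..?k}" by (auto simp: inj_on_def spider_point_def split: if_splits)
    show "?t ` {1..?k} \<inter> ?V = {}" unfolding img by auto
    show "spider_proper lam r (c(?t j := y)) = spider_proper lam r c" if "j \<in> {1..?k}" for c j y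
    proof -
      have "(c(?t j := y)) (spider_point i j') = c (spider_point i j')" if "i < r" for i j'
        using fresh[OF \<open>j \<in> {1..?k}\<close> that, of j'] by simp
      then show ?thesis by (simp add: spider_proper_def del: fun_upd_apply)
    qed
    show "h ((c(?t j := y)) (0, 0)) = h (c (0, 0))" if "j \<in> {1..?k}" for c j y
      using fresh0[OF that] by simp
  qed
  also have "\<dots> = coloring_sum x N ?V (spider_proper lam r)
      (\<lambda>c. h (c (0, 0)) * leg_poly x N ?k (c (0, 0)))"
    by (simp add: spider_point_def)
  also have "\<dots> = (\<Sum>y\<in>{1..N}. x y * ((h y * leg_poly x N ?k y) * (\<Prod>i<r. leg_poly x N (lam ! i) y)))"
    by (rule Suc.IH)
  also have "\<dots> = (\<Sum>y\<in>{1..N}. x y * (h y * (\<Prod>i<Suc r. leg_poly x N (lam ! i) y)))"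
    by (intro sum.cong refl) (simp add: ac_simps)
  finally show ?case .
qed

lemma coloring_sum_spider:
  "coloring_sum x N (pverts (spider lam)) (spider_proper lam (length lam)) (\<lambda>c. 1) =
    (\<Sum>y\<in>{1..N}. x y * (\<Prod>i<length lam. leg_poly x N (lam ! i) y))"
  using coloring_sum_spider_legs[of x N "length lam" lam "\<lambda>_. 1"] by (simp add: pverts_spider)

section \<open>From power series to polynomials\<close>

text \<open>Multisets as exponents make multiplication of monomials multiset union, so
  \<open>lookup\<close> reads coefficients in the encoding of \<open>series\<close>.\<close>

definition var :: "nat \<Rightarrow> nat multiset \<Rightarrow>\<^sub>0 int" where
  "var i = Poly_Mapping.single {#i#} 1"

lemma prod_var: "finite A \<Longrightarrow> (\<Prod>a\<in>A. var (f a)) = Poly_Mapping.single (monomial_of f A) 1"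
  by (induction A rule: finite_induct) (simp_all add: var_def monomial_of_def mult_single)

lemma lookup_sum_monomials:
  assumes "finite A" "finite C"
  shows "Poly_Mapping.lookup (\<Sum>c\<in>C. of_bool (P c) * (\<Prod>a\<in>A. var (c a))) m =
    int (card {c \<in> C. P c \<and> monomial_of c A = m})"
proof -
  have "Poly_Mapping.lookup (of_bool (P c) * (\<Prod>a\<in>A. var (c a))) m =
      (if P c \<and> monomial_of c A = m then 1 else 0)" for c
    using assms(1) by (cases "P c") (auto simp: prod_var lookup_single when_def)
  then show ?thesis
    using assms(2) by (simp only: lookup_sum) (simp add: sum.inter_filter[symmetric])
qed

text \<open>All values of c on A occur in m, so bounding the colors or entries by N loses nothing at
  the monomial m.\<close>

lemma bounded_by_monomial:
  assumes "finite A" "\<forall>i\<in>#m. i \<le> N" "monomial_of c A = m"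
  shows "c \<in> A \<rightarrow>\<^sub>E {1..} \<longleftrightarrow> c \<in> A \<rightarrow>\<^sub>E {1..N}"
proof -
  have "c a \<le> N" if "a \<in> A" for a
    using assms that by (auto simp: monomial_of_def)
  then show ?thesis by (auto simp: PiE_iff)
qed

lemma chromatic_sf_spider:
  assumes "\<forall>i\<in>#m. i \<le> N"
  shows "chromatic_sf (spider lam) m =
    Poly_Mapping.lookup (coloring_sum var N (pverts (spider lam)) (spider_proper lam (length lam)) (\<lambda>c. 1)) m"
proof -
  let ?V = "pverts (spider lam)"
  have fin: "finite ?V" by (simp add: pverts_spider)
  have proper: "(\<forall>u v. (u, v) \<in> parcs (spider lam) \<longrightarrow> c u \<noteq> c v) \<longleftrightarrow> spider_proper lam (length lam) c" for c
  proof -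
    have "(\<forall>u v. (u, v) \<in> parcs (spider lam) \<longrightarrow> c u \<noteq> c v) \<longleftrightarrow>
        (\<forall>u v. (u, v) \<in> spider_arcs lam \<longrightarrow> c u \<noteq> c v)"
      unfolding spider_def pair_pre_digraph.select_convs by (metis UnCI UnE converseD converseI)
    also have "\<dots> \<longleftrightarrow> spider_proper lam (length lam) c"
      unfolding spider_arcs_def spider_proper_def by blast
    finally show ?thesis .
  qed
  have "{c \<in> proper_colorings (spider lam). monomial_of c ?V = m} =
      {c \<in> ?V \<rightarrow>\<^sub>E {1..N}. spider_proper lam (length lam) c \<and> monomial_of c ?V = m}"
    unfolding proper_colorings_def proper
    using bounded_by_monomial[OF fin assms] by blast
  then show ?thesis
    by (simp only: chromatic_sf_def coloring_sum_def mult_1_right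
        lookup_sum_monomials[OF fin finite_PiE[OF fin finite_atLeastAtMost]])
qed

section \<open>Schur series as Schur polynomials, and transfer of positivity\<close>

lemma young_diagram_cells: "young_diagram lam = cells (part lam)"
  by (auto simp: young_diagram_part cells_def)

lemma shape_part:
  assumes "is_partition lam"
  shows "shape (part lam)"
proof -
  have "{i. 0 < part lam i} \<subseteq> {..<length lam}" by (auto simp: part_def split: if_splits)
  then show ?thesis
    using part_Suc_le[OF assms] finite_subset unfolding shape_def by blast
qed

lemma schur_eq_lookup:
  assumes lam: "is_partition lam" and m: "\<forall>i\<in>#m. i \<le> N"
  shows "schur lam m = Poly_Mapping.lookup (schur_poly var (part lam) N) m"
proof -
  let ?Y = "young_diagram lam"
  have "part lam (Suc i) \<le> part lam i" for i using part_Suc_le[OF lam] .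
  then have col: "(i, j) \<in> ?Y \<and> (Suc i, j) \<in> ?Y \<longleftrightarrow> j < part lam (Suc i)" for i j
    by (auto simp: young_diagram_part intro: less_le_trans)
  have row: "(i, j) \<in> ?Y \<and> (i, Suc j) \<in> ?Y \<longleftrightarrow> Suc j < part lam i" for i j
    by (auto simp: young_diagram_part)
  have "{T \<in> ssyt lam. monomial_of T ?Y = m} = {T \<in> tableaux (part lam) N. True \<and> monomial_of T ?Y = m}"
    unfolding ssyt_def tableaux_def row col young_diagram_cells[symmetric]
    using bounded_by_monomial[OF finite_young_diagram m] by blast
  then show ?thesis
    using lookup_sum_monomials[of ?Y "tableaux (part lam) N" "\<lambda>_. True" m]
    by (simp add: schur_def schur_poly_def young_diagram_cells[symmetric] finite_young_diagram
        finite_tableaux shape_part lam)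
qed

lemma partition_of_shape:
  assumes "shape l"
  obtains lam where "is_partition lam" "part lam = l"
proof -
  define n where "n = (LEAST n. l n = 0)"
  obtain k where "\<forall>j\<ge>k. l j = 0" using shape_eventually_zero[OF assms] .
  then have "l k = 0" by simp
  then have n: "l n = 0" unfolding n_def by (rule LeastI)
  have pos: "0 < l i" if "i < n" for i
    using not_less_Least[of i "\<lambda>n. l n = 0"] that by (simp add: n_def)
  have zero: "l i = 0" if "\<not> i < n" for i
    using shape_antimono[OF assms, of n i] that n by simp
  have "is_partition (map l [0..<n])"
    using shape_antimono[OF assms] pos by (auto simp: is_partition_def sorted_wrt_iff_nth_less)
  moreover have "part (map l [0..<n]) = l"
    using zero by (auto simp: part_def)
  ultimately show ?thesis by (rule that)
qed

lemma sum_mset_eq_sum_count: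
  "(\<Sum>l\<in>#M. f l) = (\<Sum>l\<in>set_mset M. of_nat (count M l) * (f l :: 'a::comm_ring_1))"
proof (induction M)
  case (add a M)
  have "(\<Sum>l\<in>set_mset (add_mset a M). of_nat (count (add_mset a M) l) * f l) =
      (\<Sum>l\<in>insert a (set_mset M). of_nat (count M l) * f l + (if l = a then f l else 0))"
    by (intro sum.cong) (auto simp: distrib_right)
  also have "\<dots> = (\<Sum>l\<in>insert a (set_mset M). of_nat (count M l) * f l) + f a"
    by (simp only: sum.distrib) simp
  also have "(\<Sum>l\<in>insert a (set_mset M). of_nat (count M l) * f l) = (\<Sum>l\<in>set_mset M. of_nat (count M l) * f l)"
    by (rule sum.mono_neutral_right) (auto simp: not_in_iff)
  finally show ?case using add by (simp add: add.commute)
qed simp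

text \<open>One multiset of shapes serves all N, so its multiplicities are the Schur coefficients of
  the series, although each monomial is checked in its own number of variables.\<close>

lemma schur_positive_from_schur_pos:
  assumes pos: "schur_pos var F"
    and F: "\<And>m N. \<forall>i\<in>#m. i \<le> N \<Longrightarrow> f m = Poly_Mapping.lookup (F N) m"
  shows "schur_positive f"
proof -
  obtain M where M: "\<And>l. l \<in># M \<Longrightarrow> shape l" "\<And>N. F N = (\<Sum>l\<in>#M. schur_poly var l N)"
    using pos unfolding schur_pos_def by blast
  define c where "c lam = (if is_partition lam then int (count M (part lam)) else 0)" for lam
  define L where "L = {lam. c lam \<noteq> 0}"
  have L: "L = {lam. is_partition lam \<and> part lam \<in># M}"
    by (auto simp: L_def c_def split: if_splits)
  have inj: "inj_on part L"
    by (rule inj_onI, rule partition_eqI) (auto simp: L)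
  have img: "part ` L = set_mset M"
    using M(1) partition_of_shape unfolding L by (auto simp: image_iff) metis
  have "finite L" using finite_imageD[OF _ inj] img by simp
  moreover have "f m = (\<Sum>lam\<in>L. c lam * schur lam m)" for m
  proof -
    \<comment> \<open>Inserting 0 covers the empty monomial.\<close>
    define N where "N = Max (insert 0 (set_mset m))"
    have N: "\<forall>i\<in>#m. i \<le> N" by (simp add: N_def)
    have "f m = (\<Sum>l\<in>set_mset M. int (count M l) * Poly_Mapping.lookup (schur_poly var l N) m)"
    proof -
      have "Poly_Mapping.lookup (\<Sum>l\<in>#M. schur_poly var l N) m =
          (\<Sum>l\<in>#M. Poly_Mapping.lookup (schur_poly var l N) m)"
        by (induction M) (simp_all add: lookup_add)
      then show ?thesis by (simp add: F[OF N] M(2) sum_mset_eq_sum_count)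
    qed
    also have "\<dots> = (\<Sum>lam\<in>L. int (count M (part lam)) * Poly_Mapping.lookup (schur_poly var (part lam) N) m)"
      unfolding img[symmetric] by (simp add: sum.reindex[OF inj])
    also have "\<dots> = (\<Sum>lam\<in>L. c lam * schur lam m)"
      using N by (intro sum.cong refl) (auto simp: L c_def schur_eq_lookup)
    finally show ?thesis .
  qed
  ultimately have "schur_expansion f c"
    by (auto simp: schur_expansion_def L_def c_def)
  then show ?thesis by (rule schur_positiveI) (simp add: c_def)
qed

theorem theorem4p3:
  fixes a :: nat
  assumes "a \<ge> 2"
  shows "schur_positive (chromatic_sf (spider [a, 2, 1]))"
proof -
  \<comment> \<open>The shift turns the path indices a + 4, a + 3, a + 1 into k + 5, k + 4, k +
    2.\<close>
  define k where "k = a - 1"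
  have a: "a = k + 1" using assms by (simp add: k_def)
  define F where
    "F N = coloring_sum var N (pverts (spider [a, 2, 1])) (spider_proper [a, 2, 1] (length [a, 2, 1])) (\<lambda>c. 1)" for N
  have "F N = path_poly var (k + 5) N + path_poly var 1 N * path_poly var (k + 4) N -
      path_poly var 3 N * path_poly var (k + 2) N" for N
  proof -
    have "F N = (\<Sum>y\<in>{1..N}. var y * (\<Prod>i<length [a, 2, 1]. leg_poly var N ([a, 2, 1] ! i) y))"
      unfolding F_def by (rule coloring_sum_spider)
    also have "\<dots> = (\<Sum>y\<in>{1..N}. var y * leg_poly var N a y * leg_poly var N 2 y * leg_poly var N 1 y)"
      by (intro sum.cong refl) (simp add: mult.assoc)
    also have "\<dots> = path_poly var (a + 4) N + path_poly var 1 N * path_poly var (a + 3) N -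
        path_poly var 3 N * path_poly var (a + 1) N"
      by (rule sum_leg_poly_spider)
    finally show ?thesis by (simp only: a add.assoc) simp
  qed
  then have "F = (\<lambda>N. path_poly var (k + 5) N + path_poly var 1 N * path_poly var (k + 4) N -
      path_poly var 3 N * path_poly var (k + 2) N)" by (rule HOL.ext)
  then have "schur_pos var F"
    by (simp only: schur_pos_path_combination)
  moreover have "chromatic_sf (spider [a, 2, 1]) m = Poly_Mapping.lookup (F N) m" if "\<forall>i\<in>#m. i \<le> N" for m N
    unfolding F_def using that by (rule chromatic_sf_spider)
  ultimately show ?thesis by (rule schur_positive_from_schur_pos)
qed

end
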